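(* Let $\mathcal{E}_*$ be a Hilbert space and let $K:\mathbb{D}\times\mathbb{D}\to\mathcal{B}(\mathcal{E}_* )$ be a kernel on the open unit disc $\mathbb{D}$ (not assumed to be analytic in its first variable). Then there exist a Hilbert space $\mathcal{E}$ and an operator-valued Schur function $\Theta\in\mathcal{S}(\mathbb{D},\mathcal{B}(\mathcal{E},\mathcal{E}_* ))$ such that \[ K(z,w)=\frac{I_{\mathcal{E}_*}-\Theta(z)\Theta(w)^*}{1-z\bar{w}}\qquad (z,w\in\mathbb{D}) \] if and only if the function $(z,w)\mapsto I_{\mathcal{E}_*}-(1-z\bar{w})K(z,w)$ is a kernel on $\mathbb{D}$.
   Context: $\mathcal{B}(\mathcal{E},\mathcal{E}_* )$ is the space of bounded linear operators between the Hilbert spaces $\mathcal{E}$ and $\mathcal{E}_*$, and $\mathcal{B}(\mathcal{E}_* )=\mathcal{B}(\mathcal{E}_*,\mathcal{E}_* )$. For a set $\Omega$, a function $K:\Omega\times\Omega\to\mathcal{B}(\mathcal{E}_* )$ is called a kernel (written $K\ge 0$) if $\sum_{i,j=1}^m\langle K(z_i,z_j)\eta_j,\eta_i\rangle_{\mathcal{E}_*}\ge 0$ for all $m\ge1$, $z_1,\dots,z_m\in\Omega$ and $\eta_1,\dots,\eta_m\in\mathcal{E}_*$. $\mathcal{S}(\mathbb{D},\mathcal{B}(\mathcal{E},\mathcal{E}_* ))$ denotes the set of all $\mathcal{B}(\mathcal{E},\mathcal{E}_* )$-valued analytic functions $\Theta$ on $\mathbb{D}$ with $\sup_{z\in\mathbb{D}}\|\Theta(z)\|\le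 1$. *)

theory Defs
  imports "HOL-Analysis.Analysis" "HOL-Library.Function_Algebras"
begin

text \<open>
  A complex Hilbert space is a subset of a type, so that ``there exists a Hilbert space'' can be
  stated. Addition is that of the type; the scalar multiplication and the inner product (linear
  in the first argument) are components of the structure. The inner product is only constrained
  on the carrier.
\<close>

record 'a hilbert =
  hcarrier :: "'a set"
  hscale :: "complex \<Rightarrow> 'a \<Rightarrow> 'a"
  hinner :: "'a \<Rightarrow> 'a \<Rightarrow> complex"

definition hnorm :: "'a hilbert \<Rightarrow> 'a \<Rightarrow> real" where
  "hnorm H x = sqrt (Re (hinner H x x))"

locale complex_hilbert =
  fixes H :: "'a::ab_group_add hilbert"
  assumes vector_space: "vector_space (hscale H)"
    and subspace: "module.subspace (hscale H) (hcarrier H)"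
    and inner_add_left:
      "\<lbrakk>x \<in> hcarrier H; y \<in> hcarrier H; u \<in> hcarrier H\<rbrakk>
        \<Longrightarrow> hinner H (x + y) u = hinner H x u + hinner H y u"
    and inner_scale_left:
      "\<lbrakk>x \<in> hcarrier H; u \<in> hcarrier H\<rbrakk> \<Longrightarrow> hinner H (hscale H c x) u = c * hinner H x u"
    and inner_commute:
      "\<lbrakk>x \<in> hcarrier H; y \<in> hcarrier H\<rbrakk> \<Longrightarrow> hinner H y x = cnj (hinner H x y)"
    and inner_nonneg: "x \<in> hcarrier H \<Longrightarrow> hinner H x x \<in> \<real>\<^sub>\<ge>\<^sub>0"
    and inner_definite: "\<lbrakk>x \<in> hcarrier H; hinner H x x = 0\<rbrakk> \<Longrightarrow> x = 0"
    and complete: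
      "\<lbrakk>\<And>n::nat. s n \<in> hcarrier H;
        \<And>e. e > 0 \<Longrightarrow> \<exists>N. \<forall>m\<ge>N. \<forall>n\<ge>N. hnorm H (s m - s n) < e\<rbrakk>
        \<Longrightarrow> \<exists>l\<in>hcarrier H. (\<lambda>n. hnorm H (s n - l)) \<longlonglongrightarrow> 0"

text \<open>
  Operators are functions on the whole type; only their values on the carrier matter, so two
  operators are identified when they agree on the carrier.
\<close>

definition bounded_op ::
  "'b::ab_group_add hilbert \<Rightarrow> 'a::ab_group_add hilbert \<Rightarrow> ('b \<Rightarrow> 'a) set" where
  "bounded_op E F = {T.
     (\<forall>x\<in>hcarrier E. T x \<in> hcarrier F) \<and>
     (\<forall>x\<in>hcarrier E. \<forall>y\<in>hcarrier E. T (x + y) = T x + T y) \<and>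
     (\<forall>c. \<forall>x\<in>hcarrier E. T (hscale E c x) = hscale F c (T x)) \<and>
     (\<exists>B. \<forall>x\<in>hcarrier E. hnorm F (T x) \<le> B * hnorm E x)}"

definition op_norm :: "'b hilbert \<Rightarrow> 'a hilbert \<Rightarrow> ('b \<Rightarrow> 'a) \<Rightarrow> real" where
  "op_norm E F T = (SUP x\<in>{x \<in> hcarrier E. hnorm E x \<le> 1}. hnorm F (T x))"

definition adj :: "'b hilbert \<Rightarrow> 'a hilbert \<Rightarrow> ('b \<Rightarrow> 'a) \<Rightarrow> 'a \<Rightarrow> 'b" where
  "adj E F T y =
     (THE x. x \<in> hcarrier E \<and> (\<forall>u\<in>hcarrier E. hinner F (T u) y = hinner E u x))"

definition is_kernel ::
  "'z set \<Rightarrow> 'a::ab_group_add hilbert \<Rightarrow> ('z \<Rightarrow> 'z \<Rightarrow> 'a \<Rightarrow> 'a) \<Rightarrow> bool" where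
  "is_kernel \<Omega> H K \<longleftrightarrow>
     (\<forall>z\<in>\<Omega>. \<forall>w\<in>\<Omega>. K z w \<in> bounded_op H H) \<and>
     (\<forall>m\<ge>(1::nat). \<forall>z \<eta>. (\<forall>i<m. z i \<in> \<Omega> \<and> \<eta> i \<in> hcarrier H) \<longrightarrow>
        (\<Sum>i<m. \<Sum>j<m. hinner H (K (z i) (z j) (\<eta> j)) (\<eta> i)) \<in> \<real>\<^sub>\<ge>\<^sub>0)"

text \<open>Analyticity is complex differentiability with respect to the operator norm.\<close>

definition op_analytic_on ::
  "complex set \<Rightarrow> 'b::ab_group_add hilbert \<Rightarrow> 'a::ab_group_add hilbert
    \<Rightarrow> (complex \<Rightarrow> 'b \<Rightarrow> 'a) \<Rightarrow> bool" where
  "op_analytic_on S E F \<Theta> \<longleftrightarrow>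
     (\<forall>z\<in>S. \<Theta> z \<in> bounded_op E F) \<and>
     (\<forall>z\<in>S. \<exists>A\<in>bounded_op E F.
        ((\<lambda>w. op_norm E F (\<lambda>x. hscale F (1 / (w - z)) (\<Theta> w x - \<Theta> z x) - A x)) \<longlongrightarrow> 0)
          (at z within S))"

definition schur_class ::
  "'b::ab_group_add hilbert \<Rightarrow> 'a::ab_group_add hilbert \<Rightarrow> (complex \<Rightarrow> 'b \<Rightarrow> 'a) set" where
  "schur_class E F =
     {\<Theta>. op_analytic_on (ball 0 1) E F \<Theta> \<and> (\<forall>z\<in>ball 0 1. op_norm E F (\<Theta> z) \<le> 1)}"

text \<open>
  HOL cannot quantify over types inside a formula. A Hilbert space \<open>E\<close> asserted to exist is
  sought over the type \<open>complex \<Rightarrow> 'a\<close>, where \<open>'a\<close> is the type of \<open>F\<close>; this type contains the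
  reproducing kernel Hilbert spaces of kernels on the disc with values in the operators on \<open>F\<close>.
  Statements about every \<open>E\<close> use a free type variable \<open>'b\<close>.
\<close>

definition schur_representation ::
  "'b::ab_group_add hilbert \<Rightarrow> 'a::ab_group_add hilbert
    \<Rightarrow> (complex \<Rightarrow> complex \<Rightarrow> 'a \<Rightarrow> 'a) \<Rightarrow> (complex \<Rightarrow> 'b \<Rightarrow> 'a) \<Rightarrow> bool" where
  "schur_representation E F K \<Theta> \<longleftrightarrow>
     complex_hilbert E \<and> \<Theta> \<in> schur_class E F \<and>
     (\<forall>z\<in>ball 0 1. \<forall>w\<in>ball 0 1. \<forall>x\<in>hcarrier F.
        K z w x = hscale F (1 / (1 - z * cnj w)) (x - \<Theta> z (adj E F (\<Theta> w) x)))"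

end

theory Submission imports Defs begin

text \<open>
  Write $L(z,w) = I - (1 - z\bar w)K(z,w)$. If \<open>\<Theta>\<close> represents \<open>K\<close>, then
  $L(z,w) = \Theta(z)\Theta(w)^*$, which is a kernel.

  Conversely, let \<open>E\<close> be the reproducing kernel Hilbert space of \<open>L\<close> and \<open>\<Theta>(z)\<close> the evaluation
  at \<open>z\<close>, so that $\Theta(z)\Theta(w)^* = L(z,w)$; this is a contraction because
  $L(z,z) \le I$. The issue is analyticity. For finite combinations
  $k_c = \sum c_i k_{p_i}x$ and $l_c = \sum c_i l_{p_i}x$ of the kernel
  functions $k_w x = K(\cdot,w)x$ and $l_w x = L(\cdot,w)x$, the identity $K + L = I + z\bar w K$ gives
  $\|k_c\|^2 + \|l_c\|^2 = |\sum c_i|^2\|x\|^2 + \|k_{c\bar p}\|^2$. If $\sum c_i = 0$, then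
  splitting $\bar p = \bar a + (\bar p - \bar a)$ shows that $\|k_c\|$ and $\|l_c\|$ are at most
  $\|k_{c(\bar p - \bar a)}\| / (1 - |a|)$. Applied twice to the difference of two difference
  quotients of \<open>\<Theta>\<close> at \<open>a\<close>, this shows that the difference quotients are Cauchy in operator norm.
\<close>

section \<open>Semi-inner products\<close>

text \<open>The obstacle is that nothing is known about how K(z,w) depends on z: neither K nor L is
  assumed even continuous, so analyticity has to be extracted from positivity alone. The identity
  says that the pair of x and conj(w) k_w x goes isometrically to the pair of k_w x and l_w x.
  Extending this isometry to a colligation and taking its transfer function would give an analytic
  Theta; here the isometry enters only through norm estimates, and 1/(1 - |a|) plays the role of the
  resolvent bound. Coefficients must sum to zero to remove the term in ||x||. Those of a difference
  of two difference quotients at a, taken at w and u, do so; multiplied by conj(p_i - a) they become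
  1, -1, 0, which again sum to zero. A second multiplication leaves coefficients of size |w - a| and
  |u - a|, the smallness that is wanted. One vector x in all terms is enough, because the operator
  estimate tests a value y of the difference against y itself. The space of K serves only these
  estimates.\<close>

lemma seq_null_comparison:
  fixes f :: "nat \<Rightarrow> 'a::real_normed_vector"
  assumes "g \<longlonglongrightarrow> 0" and "\<And>n. norm (f n) \<le> g n"
  shows "f \<longlonglongrightarrow> 0"
  using Lim_null_comparison[OF always_eventually assms(1)] assms(2) by blast

locale semi_hilbert =
  fixes H :: "'a::ab_group_add hilbert"
  assumes vector_space: "vector_space (hscale H)"
    and subspace: "module.subspace (hscale H) (hcarrier H)"
    and inner_add_left:
      "\<lbrakk>x \<in> hcarrier H; y \<in> hcarrier H; u \<in> hcarrier H\<rbrakk>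
        \<Longrightarrow> hinner H (x + y) u = hinner H x u + hinner H y u"
    and inner_scale_left:
      "\<lbrakk>x \<in> hcarrier H; u \<in> hcarrier H\<rbrakk> \<Longrightarrow> hinner H (hscale H c x) u = c * hinner H x u"
    and inner_commute:
      "\<lbrakk>x \<in> hcarrier H; y \<in> hcarrier H\<rbrakk> \<Longrightarrow> hinner H y x = cnj (hinner H x y)"
    and inner_nonneg: "x \<in> hcarrier H \<Longrightarrow> hinner H x x \<in> \<real>\<^sub>\<ge>\<^sub>0"
begin

sublocale vs: vector_space "hscale H" by (rule vector_space)

lemma zero_mem: "0 \<in> hcarrier H"
  using subspace vs.subspace_0 by blast

lemma add_mem: "x \<in> hcarrier H \<Longrightarrow> y \<in> hcarrier H \<Longrightarrow> x + y \<in> hcarrier H"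
  using subspace vs.subspace_add by blast

lemma scale_mem: "x \<in> hcarrier H \<Longrightarrow> hscale H c x \<in> hcarrier H"
  using subspace vs.subspace_scale by blast

lemma diff_mem: "x \<in> hcarrier H \<Longrightarrow> y \<in> hcarrier H \<Longrightarrow> x - y \<in> hcarrier H"
  using subspace vs.subspace_diff by blast

lemma sum_mem: "(\<And>i. i \<in> I \<Longrightarrow> x i \<in> hcarrier H) \<Longrightarrow> (\<Sum>i\<in>I. x i) \<in> hcarrier H"
  using subspace vs.subspace_sum by blast

lemmas mem = zero_mem add_mem scale_mem diff_mem sum_mem

lemma diff_eq: "x - y = x + hscale H (-1) y"
  by simp

lemma inner_diff_left:
  "\<lbrakk>x \<in> hcarrier H; y \<in> hcarrier H; u \<in> hcarrier H\<rbrakk>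
    \<Longrightarrow> hinner H (x - y) u = hinner H x u - hinner H y u"
  unfolding diff_eq by (simp only: inner_add_left inner_scale_left mem) simp

lemma inner_zero_left: "u \<in> hcarrier H \<Longrightarrow> hinner H 0 u = 0"
  using inner_diff_left[of 0 0 u] zero_mem by simp

lemma inner_sum_left:
  "\<lbrakk>\<And>i. i \<in> I \<Longrightarrow> x i \<in> hcarrier H; u \<in> hcarrier H\<rbrakk>
    \<Longrightarrow> hinner H (\<Sum>i\<in>I. x i) u = (\<Sum>i\<in>I. hinner H (x i) u)"
  by (induction I rule: infinite_finite_induct) (auto simp: inner_zero_left inner_add_left mem)

lemma inner_add_right:
  "\<lbrakk>x \<in> hcarrier H; y \<in> hcarrier H; u \<in> hcarrier H\<rbrakk>
    \<Longrightarrow> hinner H u (x + y) = hinner H u x + hinner H u y"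
  by (metis inner_add_left inner_commute add_mem complex_cnj_add)

lemma inner_diff_right:
  "\<lbrakk>x \<in> hcarrier H; y \<in> hcarrier H; u \<in> hcarrier H\<rbrakk>
    \<Longrightarrow> hinner H u (x - y) = hinner H u x - hinner H u y"
  by (metis inner_diff_left inner_commute diff_mem complex_cnj_diff)

lemma inner_scale_right:
  "\<lbrakk>x \<in> hcarrier H; u \<in> hcarrier H\<rbrakk> \<Longrightarrow> hinner H u (hscale H c x) = cnj c * hinner H u x"
  by (metis inner_scale_left inner_commute scale_mem complex_cnj_mult)

lemma inner_zero_right: "u \<in> hcarrier H \<Longrightarrow> hinner H u 0 = 0"
  by (metis inner_zero_left inner_commute zero_mem complex_cnj_zero)

lemma inner_sum_right:
  "\<lbrakk>\<And>i. i \<in> I \<Longrightarrow> x i \<in> hcarrier H; u \<in> hcarrier H\<rbrakk>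
    \<Longrightarrow> hinner H u (\<Sum>i\<in>I. x i) = (\<Sum>i\<in>I. hinner H u (x i))"
  by (induction I rule: infinite_finite_induct) (auto simp: inner_zero_right inner_add_right mem)

lemmas inner_simps = inner_add_left inner_add_right inner_diff_left inner_diff_right
  inner_scale_left inner_scale_right inner_zero_left inner_zero_right

lemma inner_combination_right:
  assumes "\<And>i. i \<in> I \<Longrightarrow> v i \<in> hcarrier H" "u \<in> hcarrier H"
  shows "hinner H u (\<Sum>i\<in>I. hscale H (c i) (v i)) = (\<Sum>i\<in>I. cnj (c i) * hinner H u (v i))"
proof -
  have "hinner H u (\<Sum>i\<in>I. hscale H (c i) (v i)) = (\<Sum>i\<in>I. hinner H u (hscale H (c i) (v i)))"
    using assms by (intro inner_sum_right mem)
  also have "\<dots> = (\<Sum>i\<in>I. cnj (c i) * hinner H u (v i))"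
    using assms by (intro sum.cong refl inner_scale_right)
  finally show ?thesis .
qed

lemma inner_combination:
  assumes v: "\<And>i. i \<in> I \<Longrightarrow> v i \<in> hcarrier H"
  shows "hinner H (\<Sum>i\<in>I. hscale H (c i) (v i)) (\<Sum>i\<in>I. hscale H (c i) (v i))
    = (\<Sum>i\<in>I. \<Sum>j\<in>I. c i * cnj (c j) * hinner H (v i) (v j))"
proof -
  let ?u = "\<Sum>i\<in>I. hscale H (c i) (v i)"
  have "hinner H ?u ?u = (\<Sum>i\<in>I. hinner H (hscale H (c i) (v i)) ?u)"
    using v by (intro inner_sum_left mem)
  also have "\<dots> = (\<Sum>i\<in>I. c i * hinner H (v i) ?u)"
    using v by (intro sum.cong refl inner_scale_left mem)
  also have "\<dots> = (\<Sum>i\<in>I. c i * (\<Sum>j\<in>I. cnj (c j) * hinner H (v i) (v j)))"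
    using v by (intro sum.cong refl arg_cong2[where f = "(*)"] inner_combination_right)
  finally show ?thesis by (simp add: sum_distrib_left mult.assoc)
qed

lemma inner_self: "x \<in> hcarrier H \<Longrightarrow> hinner H x x = of_real ((hnorm H x)\<^sup>2)"
  using inner_nonneg[of x] by (auto simp: hnorm_def elim!: nonneg_Reals_cases simp flip: of_real_power)

lemma hnorm_power2: "x \<in> hcarrier H \<Longrightarrow> (hnorm H x)\<^sup>2 = Re (hinner H x x)"
  by (simp add: inner_self)

lemma hnorm_nonneg: "x \<in> hcarrier H \<Longrightarrow> 0 \<le> hnorm H x"
  using inner_nonneg[of x] by (auto simp: hnorm_def elim!: nonneg_Reals_cases)

lemma hnorm_zero: "hnorm H 0 = 0"
  by (simp add: hnorm_def inner_zero_left zero_mem)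

lemma hnorm_scale: "x \<in> hcarrier H \<Longrightarrow> hnorm H (hscale H c x) = cmod c * hnorm H x"
proof -
  assume x: "x \<in> hcarrier H"
  have "hinner H (hscale H c x) (hscale H c x) = c * cnj c * hinner H x x"
    using x by (simp only: inner_scale_left inner_scale_right mem mult_ac)
  also have "\<dots> = of_real ((cmod c * hnorm H x)\<^sup>2)"
    using x by (simp add: complex_norm_square[symmetric] inner_self power_mult_distrib)
  finally have "hinner H (hscale H c x) (hscale H c x) = of_real ((cmod c * hnorm H x)\<^sup>2)" .
  then have "(hnorm H (hscale H c x))\<^sup>2 = (cmod c * hnorm H x)\<^sup>2"
    using x by (simp add: hnorm_power2 mem del: of_real_power)
  then show ?thesis
    using x hnorm_nonneg[of x] hnorm_nonneg[OF scale_mem[OF x]] power2_eq_imp_eq by fastforce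
qed

lemma hnorm_minus_commute:
  "x \<in> hcarrier H \<Longrightarrow> y \<in> hcarrier H \<Longrightarrow> hnorm H (x - y) = hnorm H (y - x)"
  using hnorm_scale[of "x - y" "-1"] diff_mem by simp

lemma hnorm_power2_add:
  "x \<in> hcarrier H \<Longrightarrow> y \<in> hcarrier H \<Longrightarrow>
    (hnorm H (x + y))\<^sup>2 = (hnorm H x)\<^sup>2 + 2 * Re (hinner H x y) + (hnorm H y)\<^sup>2"
  by (simp add: hnorm_power2 mem inner_simps) (simp add: inner_commute[of x y])

text \<open>Expand 0 <= ||x - t p y||^2 for real t, where p is the inner product of x and y. Here
  ||y|| = 0 does not force y = 0, so that case needs an argument of its own.\<close>

lemma cauchy_schwarz:
  assumes x: "x \<in> hcarrier H" and y: "y \<in> hcarrier H"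
  shows "cmod (hinner H x y) \<le> hnorm H x * hnorm H y"
proof -
  define p where "p = hinner H x y"
  have quad: "0 \<le> (hnorm H x)\<^sup>2 - 2 * t * (cmod p)\<^sup>2 + t\<^sup>2 * (cmod p)\<^sup>2 * (hnorm H y)\<^sup>2" for t :: real
  proof -
    have "0 \<le> (hnorm H (x + hscale H (- of_real t * p) y))\<^sup>2" by simp
    also have "\<dots> = (hnorm H x)\<^sup>2 + 2 * Re (hinner H x (hscale H (- of_real t * p) y))
        + (cmod (- of_real t * p) * hnorm H y)\<^sup>2"
      using x y by (simp only: hnorm_power2_add mem hnorm_scale)
    also have "hinner H x (hscale H (- of_real t * p) y) = - of_real (t * (cmod p)\<^sup>2)"
      using x y by (simp add: inner_scale_right p_def[symmetric] complex_norm_square[symmetric]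
          mult.assoc mult.commute[of "cnj p"] del: vs.scale_minus_left)
    also have "(cmod (- of_real t * p) * hnorm H y)\<^sup>2 = t\<^sup>2 * (cmod p)\<^sup>2 * (hnorm H y)\<^sup>2"
      by (simp add: norm_mult power_mult_distrib)
    finally show ?thesis by simp
  qed
  have "(cmod p)\<^sup>2 \<le> (hnorm H x * hnorm H y)\<^sup>2"
  proof (cases "hnorm H y = 0")
    case True
    have "p = 0"
    proof (rule ccontr)
      assume "p \<noteq> 0"
      then show False
        \<comment> \<open>For ||y|| = 0 the quadratic is affine in t, and this t gives it the value
          -1.\<close>
        using quad[of "((hnorm H x)\<^sup>2 + 1) / (2 * (cmod p)\<^sup>2)"] True by simp
    qed
    then show ?thesis by simp
  next
    case False
    have "0 \<le> (hnorm H x)\<^sup>2 - (cmod p)\<^sup>2 / (hnorm H y)\<^sup>2"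
      using quad[of "1 / (hnorm H y)\<^sup>2"] False
      by (simp add: power2_eq_square field_simps)
    then show ?thesis
      using False by (simp add: field_simps power_mult_distrib)
  qed
  then show ?thesis
    unfolding p_def using power2_le_imp_le mult_nonneg_nonneg hnorm_nonneg x y by blast
qed

lemma hnorm_triangle:
  assumes x: "x \<in> hcarrier H" and y: "y \<in> hcarrier H"
  shows "hnorm H (x + y) \<le> hnorm H x + hnorm H y"
proof -
  have "Re (hinner H x y) \<le> hnorm H x * hnorm H y"
    using cauchy_schwarz[OF x y] complex_Re_le_cmod order_trans by blast
  then have "(hnorm H (x + y))\<^sup>2 \<le> (hnorm H x + hnorm H y)\<^sup>2"
    using x y by (simp add: hnorm_power2_add power2_sum)
  then show ?thesis
    using power2_le_imp_le add_nonneg_nonneg hnorm_nonneg x y by blast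
qed

lemma hnorm_triangle_diff:
  assumes "x \<in> hcarrier H" "y \<in> hcarrier H" "u \<in> hcarrier H"
  shows "hnorm H (x - y) \<le> hnorm H (x - u) + hnorm H (u - y)"
  using hnorm_triangle[of "x - u" "u - y"] assms by (simp add: mem)

lemma hnorm_diff_le:
  assumes "x \<in> hcarrier H" "y \<in> hcarrier H"
  shows "hnorm H (x - y) \<le> hnorm H x + hnorm H y"
  using hnorm_triangle_diff[of x y 0] hnorm_minus_commute[of 0 y] assms by (simp add: mem)

lemma hnorm_diff_ineq:
  assumes "x \<in> hcarrier H" "y \<in> hcarrier H"
  shows "hnorm H x \<le> hnorm H y + hnorm H (x - y)"
  using hnorm_triangle[of y "x - y"] assms by (simp add: mem)

section \<open>Cauchy sequences with respect to the seminorm\<close>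

definition cauchy :: "(nat \<Rightarrow> 'a) \<Rightarrow> bool" where
  "cauchy s \<longleftrightarrow> (\<forall>n. s n \<in> hcarrier H) \<and>
     (\<forall>e>0. \<exists>N. \<forall>m\<ge>N. \<forall>n\<ge>N. hnorm H (s m - s n) < e)"

lemma cauchy_mem: "cauchy s \<Longrightarrow> s n \<in> hcarrier H"
  by (simp add: cauchy_def)

text \<open>Meant for sequences that come with a bound of this split form: the minimising sequence
  in \<open>riesz\<close>, and the difference quotients along points tending to a point of the
  disc.\<close>

lemma cauchyI_vanishing:
  assumes s: "\<And>n. s n \<in> hcarrier H" and b: "b \<longlonglongrightarrow> 0"
    and le: "\<And>m n. hnorm H (s m - s n) \<le> b m + b n"
  shows "cauchy s"
  unfolding cauchy_def
proof (intro conjI allI impI)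
  fix e :: real assume "e > 0"
  then have "eventually (\<lambda>n. b n < e / 2) sequentially"
    using order_tendstoD(2)[OF b, of "e / 2"] by simp
  then obtain N where "\<And>n. n \<ge> N \<Longrightarrow> b n < e / 2"
    by (auto simp: eventually_sequentially)
  then have "hnorm H (s m - s n) < e" if "m \<ge> N" "n \<ge> N" for m n
    using le[of m n] that by (smt (verit) field_sum_of_halves)
  then show "\<exists>N. \<forall>m\<ge>N. \<forall>n\<ge>N. hnorm H (s m - s n) < e" by blast
qed (rule s)

lemma tendsto_inner_left:
  assumes s: "\<And>n. s n \<in> hcarrier H" "l \<in> hcarrier H" "(\<lambda>n. hnorm H (s n - l)) \<longlonglongrightarrow> 0"
    and y: "y \<in> hcarrier H"
  shows "(\<lambda>n. hinner H (s n) y) \<longlonglongrightarrow> hinner H l y"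
proof (rule Lim_null[THEN iffD2], rule Lim_null_comparison)
  show "\<forall>\<^sub>F n in sequentially. norm (hinner H (s n) y - hinner H l y) \<le> hnorm H (s n - l) * hnorm H y"
    using cauchy_schwarz[of "s _ - l" y] s y by (simp add: inner_simps mem)
  show "(\<lambda>n. hnorm H (s n - l) * hnorm H y) \<longlonglongrightarrow> 0"
    using tendsto_mult_left_zero[OF s(3)] .
qed

lemma cauchy_const: "x \<in> hcarrier H \<Longrightarrow> cauchy (\<lambda>_. x)"
  by (auto simp: cauchy_def hnorm_zero)

lemma cauchy_add:
  assumes "cauchy s" "cauchy t"
  shows "cauchy (\<lambda>n. s n + t n)"
  unfolding cauchy_def
proof (intro conjI allI impI)
  fix e :: real assume "e > 0"
  then obtain M N where "\<forall>m\<ge>M. \<forall>n\<ge>M. hnorm H (s m - s n) < e / 2"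
      "\<forall>m\<ge>N. \<forall>n\<ge>N. hnorm H (t m - t n) < e / 2"
    using assms unfolding cauchy_def by (meson half_gt_zero)
  then have "hnorm H (s m - s n) + hnorm H (t m - t n) < e" if "m \<ge> max M N" "n \<ge> max M N" for m n
    using that by (metis add_strict_mono field_sum_of_halves max.bounded_iff)
  moreover have "hnorm H (s m + t m - (s n + t n)) \<le> hnorm H (s m - s n) + hnorm H (t m - t n)" for m n
    using hnorm_triangle[of "s m - s n" "t m - t n"] assms
    by (simp add: cauchy_mem mem algebra_simps)
  ultimately show "\<exists>N. \<forall>m\<ge>N. \<forall>n\<ge>N. hnorm H (s m + t m - (s n + t n)) < e"
    by (meson order_le_less_trans)
qed (use assms in \<open>simp add: cauchy_mem mem\<close>)

lemma cauchy_scale: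
  assumes "cauchy s"
  shows "cauchy (\<lambda>n. hscale H c (s n))"
  unfolding cauchy_def
proof (intro conjI allI impI)
  fix e :: real assume "e > 0"
  moreover have "cmod c + 1 > 0" by (smt (verit) norm_ge_zero)
  ultimately obtain N where N: "\<forall>m\<ge>N. \<forall>n\<ge>N. hnorm H (s m - s n) < e / (cmod c + 1)"
    using assms unfolding cauchy_def by (meson divide_pos_pos)
  have "hnorm H (hscale H c (s m) - hscale H c (s n)) < e" if "m \<ge> N" "n \<ge> N" for m n
  proof -
    have "hnorm H (hscale H c (s m) - hscale H c (s n)) = cmod c * hnorm H (s m - s n)"
      using assms by (simp add: hnorm_scale cauchy_mem mem flip: vs.scale_right_diff_distrib)
    also have "\<dots> \<le> (cmod c + 1) * hnorm H (s m - s n)"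
      using assms by (simp add: hnorm_nonneg cauchy_mem mem mult_right_mono)
    also have "\<dots> < e"
      using N that \<open>cmod c + 1 > 0\<close> by (simp add: pos_less_divide_eq mult.commute)
    finally show ?thesis .
  qed
  then show "\<exists>N. \<forall>m\<ge>N. \<forall>n\<ge>N. hnorm H (hscale H c (s m) - hscale H c (s n)) < e" by blast
qed (use assms in \<open>simp add: cauchy_mem mem\<close>)

lemma cauchy_diff: "cauchy s \<Longrightarrow> cauchy t \<Longrightarrow> cauchy (\<lambda>n. s n - t n)"
  using cauchy_add[OF _ cauchy_scale[of t "-1"]] by simp

lemma cauchy_bounded:
  assumes "cauchy s"
  shows "\<exists>B>0. \<forall>n. hnorm H (s n) \<le> B"
proof -
  obtain N where N: "\<forall>m\<ge>N. \<forall>n\<ge>N. hnorm H (s m - s n) < 1"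
    using assms unfolding cauchy_def by (meson zero_less_one)
  let ?B = "(\<Sum>n\<le>N. hnorm H (s n)) + 1"
  have nn: "0 \<le> hnorm H (s n)" for n using assms by (simp add: hnorm_nonneg cauchy_mem)
  have le: "hnorm H (s n) \<le> ?B - 1" if "n \<le> N" for n
    using that nn member_le_sum[of n "{..N}" "\<lambda>n. hnorm H (s n)"] by simp
  have "hnorm H (s n) \<le> ?B" for n
  proof (cases "n \<le> N")
    case False
    then show ?thesis
      using hnorm_diff_ineq[of "s n" "s N"] N[rule_format, of n N] le[of N] assms
      by (simp add: cauchy_mem)
  qed (use le in fastforce)
  moreover have "?B > 0" using nn by (simp add: add_nonneg_pos sum_nonneg)
  ultimately show ?thesis by blast
qed

lemma Cauchy_inner:
  assumes s: "cauchy s" and t: "cauchy t"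
  shows "Cauchy (\<lambda>n. hinner H (s n) (t n))"
proof (rule metric_CauchyI)
  fix e :: real assume "e > 0"
  obtain B where B: "B > 0" "\<And>n. hnorm H (s n) \<le> B" using cauchy_bounded[OF s] by blast
  obtain C where C: "C > 0" "\<And>n. hnorm H (t n) \<le> C" using cauchy_bounded[OF t] by blast
  obtain M where M: "\<forall>m\<ge>M. \<forall>n\<ge>M. hnorm H (s m - s n) < e / (2 * C)"
    using s \<open>e > 0\<close> \<open>C > 0\<close> unfolding cauchy_def by (meson divide_pos_pos mult_pos_pos zero_less_numeral)
  obtain N where N: "\<forall>m\<ge>N. \<forall>n\<ge>N. hnorm H (t m - t n) < e / (2 * B)"
    using t \<open>e > 0\<close> \<open>B > 0\<close> unfolding cauchy_def by (meson divide_pos_pos mult_pos_pos zero_less_numeral)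
  have "dist (hinner H (s m) (t m)) (hinner H (s n) (t n)) < e" if "m \<ge> max M N" "n \<ge> max M N" for m n
  proof -
    note memb = cauchy_mem[OF s] cauchy_mem[OF t]
    have "hinner H (s m) (t m) - hinner H (s n) (t n)
        = hinner H (s m - s n) (t m) + hinner H (s n) (t m - t n)"
      by (simp add: inner_simps memb mem)
    then have "dist (hinner H (s m) (t m)) (hinner H (s n) (t n))
        \<le> cmod (hinner H (s m - s n) (t m)) + cmod (hinner H (s n) (t m - t n))"
      by (simp add: dist_norm norm_triangle_ineq)
    also have "\<dots> \<le> hnorm H (s m - s n) * hnorm H (t m) + hnorm H (s n) * hnorm H (t m - t n)"
      by (intro add_mono cauchy_schwarz memb mem)
    also have "\<dots> \<le> hnorm H (s m - s n) * C + B * hnorm H (t m - t n)"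
      by (intro add_mono mult_left_mono mult_right_mono B C hnorm_nonneg memb mem)
    also have "\<dots> < e / 2 + e / 2"
      using M[rule_format, of m n] N[rule_format, of m n] B(1) C(1) that
      by (intro add_strict_mono) (simp_all add: field_simps)
    finally show ?thesis by simp
  qed
  then show "\<exists>M. \<forall>m\<ge>M. \<forall>n\<ge>M. dist (hinner H (s m) (t m)) (hinner H (s n) (t n)) < e" by blast
qed

text \<open>Exchanging one representing sequence for another changes inner products by terms of this
  kind, which is why the inner product of the completion does not depend on the choice.\<close>

lemma tendsto_inner_null:
  assumes s: "cauchy s" and t: "cauchy t" and null: "(\<lambda>n. hnorm H (s n)) \<longlonglongrightarrow> 0"
  shows "(\<lambda>n. hinner H (s n) (t n)) \<longlonglongrightarrow> 0"
proof -
  obtain C where C: "C > 0" "\<And>n. hnorm H (t n) \<le> C" using cauchy_bounded[OF t] by blast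
  have "cmod (hinner H (s n) (t n)) \<le> hnorm H (s n) * C" for n
    using cauchy_schwarz[of "s n" "t n"] mult_left_mono[OF C(2)[of n] hnorm_nonneg[of "s n"]]
      cauchy_mem[OF s] cauchy_mem[OF t] order_trans by blast
  then show ?thesis
    by (intro seq_null_comparison[OF tendsto_mult_left_zero[OF null, of C]])
qed

lemma tendsto_inner_null':
  assumes "cauchy s" "cauchy t" "(\<lambda>n. hnorm H (t n)) \<longlonglongrightarrow> 0"
  shows "(\<lambda>n. hinner H (s n) (t n)) \<longlonglongrightarrow> 0"
proof -
  have "(\<lambda>n. cnj (hinner H (t n) (s n))) \<longlonglongrightarrow> cnj 0"
    by (intro tendsto_cnj tendsto_inner_null assms)
  then show ?thesis
    using inner_commute[OF cauchy_mem[OF assms(2)] cauchy_mem[OF assms(1)]] by simp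
qed

end

sublocale complex_hilbert \<subseteq> semi_hilbert H
  using vector_space subspace inner_add_left inner_scale_left inner_commute inner_nonneg
  by (rule semi_hilbert.intro)

context complex_hilbert begin

lemma eqI_inner:
  assumes "x \<in> hcarrier H" "y \<in> hcarrier H" "\<And>u. u \<in> hcarrier H \<Longrightarrow> hinner H u x = hinner H u y"
  shows "x = y"
  using assms inner_definite[of "x - y"] assms(3)[of "x - y"] by (simp add: mem inner_diff_right)

lemma cauchy_convergent:
  "cauchy s \<Longrightarrow> \<exists>l\<in>hcarrier H. (\<lambda>n. hnorm H (s n - l)) \<longlonglongrightarrow> 0"
  using complete[of s] by (auto simp: cauchy_def)

lemma limit_unique:
  assumes "\<And>n. s n \<in> hcarrier H" "l \<in> hcarrier H" "l' \<in> hcarrier H"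
    "(\<lambda>n. hnorm H (s n - l)) \<longlonglongrightarrow> 0" "(\<lambda>n. hnorm H (s n - l')) \<longlonglongrightarrow> 0"
  shows "l = l'"
  by (metis assms tendsto_inner_left LIMSEQ_unique eqI_inner inner_commute)

lemma riesz:
  fixes f :: "'a \<Rightarrow> complex"
  assumes add: "\<And>x y. x \<in> hcarrier H \<Longrightarrow> y \<in> hcarrier H \<Longrightarrow> f (x + y) = f x + f y"
    and scale: "\<And>c x. x \<in> hcarrier H \<Longrightarrow> f (hscale H c x) = c * f x"
    and bounded: "\<And>x. x \<in> hcarrier H \<Longrightarrow> cmod (f x) \<le> B * hnorm H x"
  shows "\<exists>l\<in>hcarrier H. \<forall>x\<in>hcarrier H. f x = hinner H x l"
proof -
  \<comment> \<open>The representing vector is the minimiser of \<open>\<Phi>\<close>; this avoids orthogonal projections.\<close>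
  define \<Phi> where "\<Phi> x = (hnorm H x)\<^sup>2 - 2 * Re (f x)" for x
  define I where "I = Inf (\<Phi> ` hcarrier H)"
  \<comment> \<open>Completing the square: ||x||^2 - 2 B ||x|| = (||x|| - B)^2 - B^2.\<close>
  have "- B\<^sup>2 \<le> \<Phi> x" if "x \<in> hcarrier H" for x
  proof -
    have "Re (f x) \<le> B * hnorm H x"
      using bounded[OF that] complex_Re_le_cmod order_trans by blast
    moreover have "0 \<le> (hnorm H x - B)\<^sup>2" by simp
    ultimately show ?thesis by (simp add: \<Phi>_def power2_diff algebra_simps)
  qed
  then have bdd: "bdd_below (\<Phi> ` hcarrier H)" by (rule bdd_belowI2)
  then have I_le: "I \<le> \<Phi> x" if "x \<in> hcarrier H" for x
    unfolding I_def using that by (simp add: cINF_lower)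
  have "\<exists>x\<in>hcarrier H. \<Phi> x < I + 1 / real (Suc n)" for n
    using cInf_lessD[of "\<Phi> ` hcarrier H" "I + 1 / real (Suc n)"] zero_mem
    unfolding I_def[symmetric] by force
  then obtain s where s: "\<And>n. s n \<in> hcarrier H" "\<And>n. \<Phi> (s n) < I + 1 / real (Suc n)"
    by metis
  \<comment> \<open>The parallelogram law, applied with the midpoint of \<open>s m\<close> and
    \<open>s n\<close>, bounds ||s m - s n||^2 by 2/(m+1) + 2/(n+1), which is the sum of the squares
    of \<open>b m\<close> and \<open>b n\<close>.\<close>
  define b where "b n = sqrt (2 / real (Suc n))" for n
  have "hnorm H (s m - s n) \<le> b m + b n" for m n
  proof -
    let ?x = "s m" and ?y = "s n"
    let ?h = "hscale H (1/2) (?x + ?y)"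
    have p: "(hnorm H (?x - ?y))\<^sup>2 = (hnorm H ?x)\<^sup>2 - 2 * Re (hinner H ?x ?y) + (hnorm H ?y)\<^sup>2"
      using hnorm_power2_add[of ?x "hscale H (-1) ?y"] s
      by (simp only: hnorm_scale inner_scale_right mem flip: diff_eq) simp
    have h: "\<Phi> ?h = ((hnorm H ?x)\<^sup>2 + 2 * Re (hinner H ?x ?y) + (hnorm H ?y)\<^sup>2) / 4
        - (Re (f ?x) + Re (f ?y))"
      unfolding \<Phi>_def using s
      by (simp add: hnorm_scale mem scale add power_divide hnorm_power2_add add_divide_distrib)
    have "(hnorm H (?x - ?y))\<^sup>2 = 2 * (\<Phi> ?x + \<Phi> ?y - 2 * \<Phi> ?h)"
      unfolding h p by (simp add: \<Phi>_def field_simps)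
    also have "\<dots> \<le> 2 / real (Suc m) + 2 / real (Suc n)"
      using s(2)[of m] s(2)[of n] I_le[of ?h] s(1) by (simp add: mem)
    also have "\<dots> \<le> (b m + b n)\<^sup>2"
      by (simp add: b_def power2_sum)
    finally show ?thesis
      by (rule power2_le_imp_le) (simp add: b_def)
  qed
  moreover have "b \<longlonglongrightarrow> 0"
  proof -
    have "(\<lambda>n. sqrt (2 * inverse (real (Suc n)))) \<longlonglongrightarrow> sqrt (2 * 0)"
      by (intro tendsto_intros LIMSEQ_inverse_real_of_nat)
    then show ?thesis by (simp add: b_def[abs_def] divide_inverse)
  qed
  ultimately have "cauchy s" using s(1) by (intro cauchyI_vanishing)
  then obtain l where l: "l \<in> hcarrier H" "(\<lambda>n. hnorm H (s n - l)) \<longlonglongrightarrow> 0"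
    using cauchy_convergent by blast
  \<comment> \<open>This says that moving from the limit \<open>l\<close> to \<open>l + h\<close>
    does not decrease \<open>\<Phi>\<close>; it is obtained by letting n tend to infinity in the
    near-minimality of \<open>s n\<close>.\<close>
  have ineq: "0 \<le> (hnorm H h)\<^sup>2 + 2 * Re (hinner H l h) - 2 * Re (f h)" if h: "h \<in> hcarrier H" for h
  proof (rule tendsto_lowerbound)
    show "(\<lambda>n. 1 / real (Suc n) + (hnorm H h)\<^sup>2 + 2 * Re (hinner H (s n) h) - 2 * Re (f h))
        \<longlonglongrightarrow> (hnorm H h)\<^sup>2 + 2 * Re (hinner H l h) - 2 * Re (f h)"
    proof -
      have "(\<lambda>n. inverse (real (Suc n)) + (hnorm H h)\<^sup>2 + 2 * Re (hinner H (s n) h) - 2 * Re (f h))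
        \<longlonglongrightarrow> 0 + (hnorm H h)\<^sup>2 + 2 * Re (hinner H l h) - 2 * Re (f h)"
        by (intro tendsto_intros LIMSEQ_inverse_real_of_nat tendsto_inner_left s l h)
      then show ?thesis by (simp add: divide_inverse)
    qed
    show "\<forall>\<^sub>F n in sequentially.
        0 \<le> 1 / real (Suc n) + (hnorm H h)\<^sup>2 + 2 * Re (hinner H (s n) h) - 2 * Re (f h)"
    proof (intro always_eventually allI)
      fix n
      have "\<Phi> (s n) < \<Phi> (s n + h) + 1 / real (Suc n)"
        using s(2)[of n] I_le[of "s n + h"] s(1)[of n] h by (simp add: mem)
      also have "\<Phi> (s n + h) = \<Phi> (s n) + (hnorm H h)\<^sup>2 + 2 * Re (hinner H (s n) h) - 2 * Re (f h)"
        using s(1)[of n] h by (simp add: \<Phi>_def hnorm_power2_add add)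
      finally show "0 \<le> 1 / real (Suc n) + (hnorm H h)\<^sup>2 + 2 * Re (hinner H (s n) h) - 2 * Re (f h)"
        by simp
    qed
  qed simp
  have re: "Re (f h) = Re (hinner H h l)" if h: "h \<in> hcarrier H" for h
  proof -
    define d where "d = Re (hinner H l h) - Re (f h)"
    have quad: "0 \<le> t\<^sup>2 * (hnorm H h)\<^sup>2 + 2 * t * d" for t :: real
      using ineq[of "hscale H (of_real t) h"] h l
      by (simp add: mem hnorm_scale inner_scale_right scale power_mult_distrib d_def algebra_simps)
    have "d = 0"
    proof -
      \<comment> \<open>The summand 1 keeps q positive when h has norm 0. At t = - d / q the
        quadratic is at most - d^2 / q, which forces d = 0.\<close>
      define q where "q = (hnorm H h)\<^sup>2 + 1"
      have "q > 0" unfolding q_def by (smt (verit) zero_le_power2)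
      have "0 \<le> (d / q)\<^sup>2 * (hnorm H h)\<^sup>2 - 2 * (d / q) * d"
        using quad[of "- d / q"] by simp
      also have "\<dots> \<le> (d / q)\<^sup>2 * q - 2 * (d / q) * d"
        by (simp add: q_def mult_left_mono)
      also have "\<dots> = - (d\<^sup>2 / q)"
        using \<open>q > 0\<close> by (simp add: power2_eq_square field_simps)
      finally show ?thesis using \<open>q > 0\<close> by (simp add: field_simps)
    qed
    then show ?thesis using inner_commute[OF h l(1)] by (simp add: d_def)
  qed
  have "f x = hinner H x l" if x: "x \<in> hcarrier H" for x
    \<comment> \<open>Equality of real parts at i x is equality of imaginary parts at x.\<close>
    using re[OF x] re[of "hscale H \<i> x"] x l by (simp add: mem scale inner_scale_left complex_eq_iff)
  then show ?thesis using l(1) by blast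
qed

end

section \<open>Completion\<close>

text \<open>
  Elements of \<open>'h\<close> encode Cauchy sequences modulo null sequences. This makes the completion live
  in a prescribed type instead of a quotient type.
\<close>

locale hilbert_completion = V: semi_hilbert V
  for V :: "'v::ab_group_add hilbert" +
  fixes sc :: "complex \<Rightarrow> 'h::ab_group_add \<Rightarrow> 'h"
    and represents :: "(nat \<Rightarrow> 'v) \<Rightarrow> 'h \<Rightarrow> bool"
  assumes vector_space_sc: "vector_space sc"
    and represents_add:
      "\<lbrakk>V.cauchy s; represents s f; V.cauchy t; represents t g\<rbrakk>
        \<Longrightarrow> represents (\<lambda>n. s n + t n) (f + g)"
    and represents_scale:
      "\<lbrakk>V.cauchy s; represents s f\<rbrakk> \<Longrightarrow> represents (\<lambda>n. hscale V c (s n)) (sc c f)"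
    and represents_ex: "V.cauchy s \<Longrightarrow> \<exists>f. represents s f"
    and represents_zero_iff:
      "\<lbrakk>V.cauchy s; represents s f\<rbrakk> \<Longrightarrow> f = 0 \<longleftrightarrow> (\<lambda>n. hnorm V (s n)) \<longlonglongrightarrow> 0"
begin

sublocale sc: vector_space sc by (rule vector_space_sc)

definition carr :: "'h set" where
  "carr = {f. \<exists>s. V.cauchy s \<and> represents s f}"

definition rep :: "'h \<Rightarrow> nat \<Rightarrow> 'v" where
  "rep f = (SOME s. V.cauchy s \<and> represents s f)"

definition completion :: "'h hilbert" where
  "completion = \<lparr>hcarrier = carr, hscale = sc,
     hinner = (\<lambda>f g. lim (\<lambda>n. hinner V (rep f n) (rep g n)))\<rparr>"

lemma sel: "hcarrier completion = carr" "hscale completion = sc"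
  by (simp_all add: completion_def)

lemma carrE: "f \<in> carr \<Longrightarrow> (\<And>s. V.cauchy s \<Longrightarrow> represents s f \<Longrightarrow> P) \<Longrightarrow> P"
  by (auto simp: carr_def)

lemma carrI: "V.cauchy s \<Longrightarrow> represents s f \<Longrightarrow> f \<in> carr"
  by (auto simp: carr_def)

lemma represents_diff:
  assumes "V.cauchy s" "represents s f" "V.cauchy t" "represents t g"
  shows "represents (\<lambda>n. s n - t n) (f - g)"
  using represents_add[OF assms(1,2) V.cauchy_scale[OF assms(3), of "-1"]
      represents_scale[OF assms(3,4), of "-1"]] by simp

text \<open>\<open>completion\<close> is defined through chosen representatives. Since
  \<open>s - rep f\<close> represents 0, it is null, and likewise for \<open>t\<close>; the inner
  product of \<open>s\<close> and \<open>t\<close> differs from that of the chosen sequences by two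
  terms with a null factor.\<close>

lemma tendsto_inner_completion:
  assumes s: "V.cauchy s" "represents s f" and t: "V.cauchy t" "represents t g"
  shows "(\<lambda>n. hinner V (s n) (t n)) \<longlonglongrightarrow> hinner completion f g"
proof -
  have r: "V.cauchy (rep f)" "represents (rep f) f" "V.cauchy (rep g)" "represents (rep g) g"
    unfolding rep_def using someI_ex s t by (metis (mono_tags, lifting))+
  note memb = V.cauchy_mem[OF s(1)] V.cauchy_mem[OF t(1)] V.cauchy_mem[OF r(1)] V.cauchy_mem[OF r(3)]
  have null: "(\<lambda>n. hnorm V (s n - rep f n)) \<longlonglongrightarrow> 0" "(\<lambda>n. hnorm V (t n - rep g n)) \<longlonglongrightarrow> 0"
    using represents_zero_iff[OF V.cauchy_diff[OF s(1) r(1)] represents_diff[OF s r(1,2)]]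
      represents_zero_iff[OF V.cauchy_diff[OF t(1) r(3)] represents_diff[OF t r(3,4)]] by simp_all
  have "(\<lambda>n. hinner V (rep f n) (rep g n)) \<longlonglongrightarrow> hinner completion f g"
    using V.Cauchy_inner[OF r(1,3)] by (simp add: completion_def Cauchy_convergent convergent_LIMSEQ_iff[symmetric])
  moreover have "(\<lambda>n. hinner V (s n - rep f n) (t n)) \<longlonglongrightarrow> 0"
    by (intro V.tendsto_inner_null V.cauchy_diff s t r null)
  moreover have "(\<lambda>n. hinner V (rep f n) (t n - rep g n)) \<longlonglongrightarrow> 0"
    by (intro V.tendsto_inner_null' V.cauchy_diff s t r null)
  ultimately have "(\<lambda>n. hinner V (rep f n) (rep g n) + hinner V (s n - rep f n) (t n)
      + hinner V (rep f n) (t n - rep g n)) \<longlonglongrightarrow> hinner completion f g + 0 + 0"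
    by (intro tendsto_add)
  then show ?thesis by (simp add: V.inner_simps memb V.mem)
qed

lemma completion_semi_hilbert: "semi_hilbert completion"
proof (rule semi_hilbert.intro)
  show "vector_space (hscale completion)" by (simp add: sel vector_space_sc)
  show "module.subspace (hscale completion) (hcarrier completion)"
    unfolding sel
  proof (rule sc.subspaceI)
    obtain f where f: "represents (\<lambda>_. 0) f"
      using represents_ex[OF V.cauchy_const[OF V.zero_mem]] by blast
    then show "0 \<in> carr"
      using represents_zero_iff[OF V.cauchy_const[OF V.zero_mem] f]
      by (auto simp: V.hnorm_zero intro: carrI[OF V.cauchy_const[OF V.zero_mem]])
  qed (auto elim!: carrE intro: carrI V.cauchy_add represents_add V.cauchy_scale represents_scale)
next
  fix x y u assume "x \<in> hcarrier completion" "y \<in> hcarrier completion" "u \<in> hcarrier completion"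
  then obtain s t r where st: "V.cauchy s" "represents s x" "V.cauchy t" "represents t y"
    and r: "V.cauchy r" "represents r u" by (metis carrE sel(1))
  have "(\<lambda>n. hinner V (s n + t n) (r n)) \<longlonglongrightarrow> hinner completion (x + y) u"
    by (intro tendsto_inner_completion V.cauchy_add represents_add st r)
  moreover have "(\<lambda>n. hinner V (s n) (r n) + hinner V (t n) (r n))
      \<longlonglongrightarrow> hinner completion x u + hinner completion y u"
    by (intro tendsto_add tendsto_inner_completion st r)
  ultimately show "hinner completion (x + y) u = hinner completion x u + hinner completion y u"
    using LIMSEQ_unique by (simp add: V.inner_simps V.cauchy_mem st r)
next
  fix x u c assume "x \<in> hcarrier completion" "u \<in> hcarrier completion"
  then obtain s r where s: "V.cauchy s" "represents s x"
    and r: "V.cauchy r" "represents r u" by (metis carrE sel(1))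
  have "(\<lambda>n. hinner V (hscale V c (s n)) (r n)) \<longlonglongrightarrow> hinner completion (sc c x) u"
    by (intro tendsto_inner_completion V.cauchy_scale represents_scale s r)
  moreover have "(\<lambda>n. c * hinner V (s n) (r n)) \<longlonglongrightarrow> c * hinner completion x u"
    by (intro tendsto_mult_left tendsto_inner_completion s r)
  ultimately show "hinner completion (hscale completion c x) u = c * hinner completion x u"
    using LIMSEQ_unique by (simp add: V.inner_simps V.cauchy_mem s r sel)
next
  fix x y assume "x \<in> hcarrier completion" "y \<in> hcarrier completion"
  then obtain s r where s: "V.cauchy s" "represents s x"
    and r: "V.cauchy r" "represents r y" by (metis carrE sel(1))
  have "(\<lambda>n. cnj (hinner V (s n) (r n))) \<longlonglongrightarrow> cnj (hinner completion x y)"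
    by (intro tendsto_cnj tendsto_inner_completion s r)
  moreover have "cnj (hinner V (s n) (r n)) = hinner V (r n) (s n)" for n
    using V.inner_commute V.cauchy_mem s r by metis
  ultimately show "hinner completion y x = cnj (hinner completion x y)"
    using tendsto_inner_completion[OF r s] LIMSEQ_unique by simp
next
  fix x assume "x \<in> hcarrier completion"
  then obtain s where s: "V.cauchy s" "represents s x" by (metis carrE sel(1))
  show "hinner completion x x \<in> \<real>\<^sub>\<ge>\<^sub>0"
    using closed_sequentially[OF closed_nonneg_Reals_complex _ tendsto_inner_completion[OF s s]]
      V.inner_nonneg V.cauchy_mem[OF s(1)] by blast
qed

lemma tendsto_hnorm_completion:
  assumes "V.cauchy s" "represents s f"
  shows "(\<lambda>n. hnorm V (s n)) \<longlonglongrightarrow> hnorm completion f"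
  unfolding hnorm_def by (intro tendsto_intros tendsto_inner_completion assms)

text \<open>Density: constant sequences embed \<open>V\<close> into the completion, and the embedded
  terms of a representing sequence converge to the element it represents.\<close>

lemma tendsto_represented:
  assumes s: "V.cauchy s" "represents s f" and g: "\<And>m. represents (\<lambda>_. s m) (g m)"
  shows "(\<lambda>m. hnorm completion (g m - f)) \<longlonglongrightarrow> 0"
proof (rule LIMSEQ_I)
  fix e :: real assume "e > 0"
  then obtain N where N: "\<forall>m\<ge>N. \<forall>n\<ge>N. hnorm V (s m - s n) < e / 2"
    using s(1) unfolding V.cauchy_def by (meson half_gt_zero)
  have "norm (hnorm completion (g m - f) - 0) < e" if "m \<ge> N" for m
  proof -
    have lim: "(\<lambda>n. hnorm V (s m - s n)) \<longlonglongrightarrow> hnorm completion (g m - f)"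
      by (intro tendsto_hnorm_completion V.cauchy_diff represents_diff V.cauchy_const V.cauchy_mem s g)
    have "hnorm completion (g m - f) \<le> e / 2"
    proof (rule tendsto_upperbound[OF lim])
      show "\<forall>\<^sub>F n in sequentially. hnorm V (s m - s n) \<le> e / 2"
        using N that unfolding eventually_sequentially by (meson less_imp_le)
    qed simp
    moreover have "0 \<le> hnorm completion (g m - f)"
      using tendsto_lowerbound[OF lim] V.hnorm_nonneg V.diff_mem V.cauchy_mem[OF s(1)] by simp
    ultimately show ?thesis using \<open>e > 0\<close> by simp
  qed
  then show "\<exists>N. \<forall>m\<ge>N. norm (hnorm completion (g m - f) - 0) < e" by blast
qed

text \<open>For completeness, density provides vectors \<open>v n\<close> of \<open>V\<close> within
  1/(n+1) of the n-th term. The embedding is isometric, so \<open>v\<close> is Cauchy in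
  \<open>V\<close>, and the element that \<open>v\<close> represents is the limit.\<close>

theorem completion_hilbert: "complex_hilbert completion"
proof -
  interpret C: semi_hilbert completion by (rule completion_semi_hilbert)
  have definite: "f = 0" if f: "f \<in> hcarrier completion" and 0: "hinner completion f f = 0" for f
  proof -
    obtain s where s: "V.cauchy s" "represents s f" using f by (metis carrE sel(1))
    have "hnorm completion f = 0" using 0 by (simp add: hnorm_def)
    then show ?thesis using represents_zero_iff[OF s] tendsto_hnorm_completion[OF s] by simp
  qed
  have complete: "\<exists>l\<in>hcarrier completion. (\<lambda>n. hnorm completion (s n - l)) \<longlonglongrightarrow> 0"
    if s: "\<And>n::nat. s n \<in> hcarrier completion"
      and cau: "\<And>e. e > 0 \<Longrightarrow> \<exists>N. \<forall>m\<ge>N. \<forall>n\<ge>N. hnorm completion (s m - s n) < e" for s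
  proof -
    have "\<exists>v g. v \<in> hcarrier V \<and> represents (\<lambda>_. v) g \<and> hnorm completion (s n - g) < inverse (real (Suc n))"
      for n
    proof -
      obtain t where t: "V.cauchy t" "represents t (s n)" using s by (metis carrE sel(1))
      obtain g where g: "\<And>m. represents (\<lambda>_. t m) (g m)"
        using represents_ex[OF V.cauchy_const[OF V.cauchy_mem[OF t(1)]]] by metis
      have "\<forall>\<^sub>F m in sequentially. hnorm completion (g m - s n) < inverse (real (Suc n))"
        using order_tendstoD(2)[OF tendsto_represented[OF t g]] by simp
      then obtain m where "hnorm completion (g m - s n) < inverse (real (Suc n))"
        by (auto simp: eventually_sequentially)
      moreover have "g m \<in> hcarrier completion"
        unfolding sel using carrI[OF V.cauchy_const[OF V.cauchy_mem[OF t(1)]] g] .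
      ultimately show ?thesis
        using g V.cauchy_mem[OF t(1)] C.hnorm_minus_commute[of "g m" "s n"] s by auto
    qed
    then obtain v g where v: "\<And>n. v n \<in> hcarrier V" and g: "\<And>n. represents (\<lambda>_. v n) (g n)"
      and approx: "\<And>n. hnorm completion (s n - g n) < inverse (real (Suc n))" by metis
    have gmem: "g n \<in> hcarrier completion" for n
      unfolding sel using carrI[OF V.cauchy_const[OF v] g] .
    have vg: "hnorm V (v m - v n) = hnorm completion (g m - g n)" for m n
      using tendsto_hnorm_completion[OF V.cauchy_diff represents_diff, of "\<lambda>_. v m" "\<lambda>_. v n"]
        V.cauchy_const v g LIMSEQ_const_iff by metis
    have "V.cauchy v"
      unfolding V.cauchy_def
    proof (intro conjI allI impI v)
      fix e :: real assume "e > 0"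
      then obtain N where N: "\<And>m n. m \<ge> N \<Longrightarrow> n \<ge> N \<Longrightarrow> hnorm completion (s m - s n) < e / 3"
        using cau[of "e / 3"] by auto
      obtain M where M: "inverse (real (Suc M)) < e / 3"
        using reals_Archimedean[of "e / 3"] \<open>e > 0\<close> by auto
      have near: "hnorm completion (s n - g n) < e / 3" if "n \<ge> M" for n
      proof -
        have "inverse (real (Suc n)) \<le> inverse (real (Suc M))"
          using that by (intro le_imp_inverse_le) auto
        then show ?thesis using approx[of n] M by linarith
      qed
      have "hnorm V (v m - v n) < e" if "m \<ge> max M N" "n \<ge> max M N" for m n
      proof -
        have "hnorm completion (g m - g n) \<le> hnorm completion (g m - s m) + hnorm completion (s m - g n)"
          by (intro C.hnorm_triangle_diff gmem s)
        also have "hnorm completion (s m - g n) \<le> hnorm completion (s m - s n) + hnorm completion (s n - g n)"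
          by (intro C.hnorm_triangle_diff gmem s)
        finally show ?thesis
          using near[of m] near[of n] N[of m n] that C.hnorm_minus_commute[OF s gmem, of m m]
          by (simp add: vg)
      qed
      then show "\<exists>N. \<forall>m\<ge>N. \<forall>n\<ge>N. hnorm V (v m - v n) < e" by blast
    qed
    then obtain l where l: "represents v l" using represents_ex by blast
    have lmem: "l \<in> hcarrier completion"
      unfolding sel using carrI \<open>V.cauchy v\<close> l by blast
    have "(\<lambda>n. inverse (real (Suc n)) + hnorm completion (g n - l)) \<longlonglongrightarrow> 0"
      by (intro tendsto_add_zero LIMSEQ_inverse_real_of_nat tendsto_represented[OF \<open>V.cauchy v\<close> l g])
    moreover have "norm (hnorm completion (s n - l)) \<le> inverse (real (Suc n)) + hnorm completion (g n - l)"
      for n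
      using C.hnorm_triangle_diff[OF s lmem gmem, of n n] C.hnorm_nonneg[OF C.diff_mem[OF s lmem], of n]
        approx[of n] by simp
    ultimately have "(\<lambda>n. hnorm completion (s n - l)) \<longlonglongrightarrow> 0"
      by (rule seq_null_comparison)
    then show ?thesis using lmem by blast
  qed
  show ?thesis
    using C.vector_space C.subspace C.inner_add_left C.inner_scale_left C.inner_commute
      C.inner_nonneg definite complete
    by (rule complex_hilbert.intro)
qed

end

section \<open>Reproducing kernel Hilbert spaces\<close>

definition pointwise_scale :: "'a hilbert \<Rightarrow> complex \<Rightarrow> ('z \<Rightarrow> 'a) \<Rightarrow> 'z \<Rightarrow> 'a" where
  "pointwise_scale F c f = (\<lambda>z. hscale F c (f z))"

locale operator_kernel = F: complex_hilbert F
  for F :: "'a::ab_group_add hilbert" +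
  fixes \<Omega> :: "'z set" and K :: "'z \<Rightarrow> 'z \<Rightarrow> 'a \<Rightarrow> 'a"
  assumes kernel: "is_kernel \<Omega> F K"
begin

lemma K_op: "z \<in> \<Omega> \<Longrightarrow> w \<in> \<Omega> \<Longrightarrow> K z w \<in> bounded_op F F"
  using kernel by (simp add: is_kernel_def)

lemma
  assumes "z \<in> \<Omega>" "w \<in> \<Omega>" "x \<in> hcarrier F"
  shows K_mem: "K z w x \<in> hcarrier F"
    and K_add: "y \<in> hcarrier F \<Longrightarrow> K z w (x + y) = K z w x + K z w y"
    and K_scale: "K z w (hscale F c x) = hscale F c (K z w x)"
  using K_op[OF assms(1,2)] assms(3) by (auto simp: bounded_op_def)

lemma K_zero: "z \<in> \<Omega> \<Longrightarrow> w \<in> \<Omega> \<Longrightarrow> K z w 0 = 0"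
  using K_scale[of z w 0 0] F.zero_mem by simp

text \<open>
  A finitely supported \<open>\<phi>\<close> stands for the formal combination of the kernel functions
  $K(\cdot,z)\varphi(z)$; \<open>eval\<close> gives its values as a function. Working with formal combinations
  makes the inner product well defined from the start; it is only semidefinite.
\<close>

definition finsupp :: "('z \<Rightarrow> 'a) set" where
  "finsupp = {\<phi>. finite {z. \<phi> z \<noteq> 0} \<and> {z. \<phi> z \<noteq> 0} \<subseteq> \<Omega> \<and> range \<phi> \<subseteq> hcarrier F}"

definition form :: "('z \<Rightarrow> 'a) \<Rightarrow> ('z \<Rightarrow> 'a) \<Rightarrow> complex" where
  "form \<phi> \<psi> = (\<Sum>z | \<phi> z \<noteq> 0. \<Sum>w | \<psi> w \<noteq> 0. hinner F (K w z (\<phi> z)) (\<psi> w))"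

definition eval :: "('z \<Rightarrow> 'a) \<Rightarrow> 'z \<Rightarrow> 'a" where
  "eval \<phi> z = (\<Sum>w | \<phi> w \<noteq> 0. K z w (\<phi> w))"

definition single :: "'z \<Rightarrow> 'a \<Rightarrow> 'z \<Rightarrow> 'a" where
  "single z \<eta> = (\<lambda>w. if w = z then \<eta> else 0)"

definition formal_space :: "('z \<Rightarrow> 'a) hilbert" where
  "formal_space = \<lparr>hcarrier = finsupp, hscale = pointwise_scale F, hinner = form\<rparr>"

lemma formal_space_sel:
  "hcarrier formal_space = finsupp" "hscale formal_space = pointwise_scale F"
  "hinner formal_space = form"
  by (simp_all add: formal_space_def)

lemma finsuppD:
  assumes "\<phi> \<in> finsupp"
  shows "finite {z. \<phi> z \<noteq> 0}" "{z. \<phi> z \<noteq> 0} \<subseteq> \<Omega>" "\<phi> z \<in> hcarrier F"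
  using assms by (auto simp: finsupp_def)

lemma single_finsupp: "z \<in> \<Omega> \<Longrightarrow> \<eta> \<in> hcarrier F \<Longrightarrow> single z \<eta> \<in> finsupp"
  by (auto simp: finsupp_def single_def F.zero_mem)

lemma support_single: "{w. single z \<eta> w \<noteq> 0} \<subseteq> {z}"
  by (auto simp: single_def)

lemma support_add: "{z. (\<phi> + \<psi>) z \<noteq> 0} \<subseteq> {z. \<phi> z \<noteq> 0} \<union> {z. \<psi> z \<noteq> (0::'a)}"
  by auto

text \<open>The additional terms vanish. The freedom in the index sets matters because sums over
  different supports have to be compared, and the support of a sum may be smaller than the union of
  the supports.\<close>

lemma form_eq:
  assumes "\<phi> \<in> finsupp" "\<psi> \<in> finsupp"
    and S: "finite S" "S \<subseteq> \<Omega>" "{z. \<phi> z \<noteq> 0} \<subseteq> S"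
    and T: "finite T" "T \<subseteq> \<Omega>" "{z. \<psi> z \<noteq> 0} \<subseteq> T"
  shows "form \<phi> \<psi> = (\<Sum>z\<in>S. \<Sum>w\<in>T. hinner F (K w z (\<phi> z)) (\<psi> w))"
proof -
  have "form \<phi> \<psi> = (\<Sum>z | \<phi> z \<noteq> 0. \<Sum>w\<in>T. hinner F (K w z (\<phi> z)) (\<psi> w))"
    unfolding form_def
    by (intro sum.cong refl sum.mono_neutral_left T ballI)
      (use S T assms(1) in \<open>auto simp: F.inner_zero_right finsuppD K_mem subset_iff\<close>)
  also have "\<dots> = (\<Sum>z\<in>S. \<Sum>w\<in>T. hinner F (K w z (\<phi> z)) (\<psi> w))"
    by (intro sum.mono_neutral_left S ballI sum.neutral)
      (use S T assms(2) in \<open>auto simp: F.inner_zero_left finsuppD K_zero subset_iff\<close>)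
  finally show ?thesis .
qed

lemma eval_eq:
  assumes "\<phi> \<in> finsupp" "z \<in> \<Omega>" "finite S" "S \<subseteq> \<Omega>" "{z. \<phi> z \<noteq> 0} \<subseteq> S"
  shows "eval \<phi> z = (\<Sum>w\<in>S. K z w (\<phi> w))"
  unfolding eval_def
  by (intro sum.mono_neutral_left assms ballI) (use assms in \<open>auto simp: K_zero subset_iff\<close>)

lemma eval_mem: "\<phi> \<in> finsupp \<Longrightarrow> z \<in> \<Omega> \<Longrightarrow> eval \<phi> z \<in> hcarrier F"
  unfolding eval_def by (intro F.sum_mem K_mem) (auto dest: finsuppD)

text \<open>The reproducing property at the level of formal combinations. It reduces linearity of
  \<open>form\<close> in the first argument to linearity of \<open>eval\<close>.\<close>

lemma form_eval:
  assumes "\<phi> \<in> finsupp" "\<psi> \<in> finsupp" "finite T" "T \<subseteq> \<Omega>" "{z. \<psi> z \<noteq> 0} \<subseteq> T"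
  shows "form \<phi> \<psi> = (\<Sum>w\<in>T. hinner F (eval \<phi> w) (\<psi> w))"
proof -
  have "form \<phi> \<psi> = (\<Sum>w\<in>T. \<Sum>z | \<phi> z \<noteq> 0. hinner F (K w z (\<phi> z)) (\<psi> w))"
    using assms finsuppD[OF assms(1)] by (subst sum.swap) (rule form_eq; simp)
  also have "\<dots> = (\<Sum>w\<in>T. hinner F (eval \<phi> w) (\<psi> w))"
    unfolding eval_def using assms finsuppD[OF assms(1)]
    by (intro sum.cong refl F.inner_sum_left[symmetric] K_mem) (auto dest: finsuppD)
  finally show ?thesis .
qed

lemma form_single:
  assumes "\<phi> \<in> finsupp" "z \<in> \<Omega>" "\<eta> \<in> hcarrier F"
  shows "form \<phi> (single z \<eta>) = hinner F (eval \<phi> z) \<eta>"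
  using form_eval[OF assms(1) single_finsupp[OF assms(2,3)] _ _ support_single] assms
  by (simp add: single_def)

lemma eval_single:
  assumes "w \<in> \<Omega>" "z \<in> \<Omega>" "\<eta> \<in> hcarrier F"
  shows "eval (single z \<eta>) w = K w z \<eta>"
  using eval_eq[OF single_finsupp[OF assms(2,3)] assms(1) _ _ support_single] assms
  by (simp add: single_def)

lemma finsupp_add: "\<phi> \<in> finsupp \<Longrightarrow> \<psi> \<in> finsupp \<Longrightarrow> \<phi> + \<psi> \<in> finsupp"
proof -
  assume *: "\<phi> \<in> finsupp" "\<psi> \<in> finsupp"
  have "finite {z. (\<phi> + \<psi>) z \<noteq> 0}" "{z. (\<phi> + \<psi>) z \<noteq> 0} \<subseteq> \<Omega>"
    using finite_subset[OF support_add finite_UnI] subset_trans[OF support_add Un_least]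
      finsuppD(1,2)[OF *(1)] finsuppD(1,2)[OF *(2)] by blast+
  then show ?thesis
    using finsuppD(3)[OF *(1)] finsuppD(3)[OF *(2)] by (auto simp: finsupp_def intro!: F.add_mem)
qed

lemma finsupp_scale: "\<phi> \<in> finsupp \<Longrightarrow> pointwise_scale F c \<phi> \<in> finsupp"
proof -
  assume *: "\<phi> \<in> finsupp"
  have "{z. pointwise_scale F c \<phi> z \<noteq> 0} \<subseteq> {z. \<phi> z \<noteq> 0}" by (auto simp: pointwise_scale_def)
  then show ?thesis
    using finsuppD[OF *] unfolding finsupp_def
    by (auto simp: pointwise_scale_def intro!: F.scale_mem intro: finite_subset)
qed

lemma eval_add:
  assumes "\<phi> \<in> finsupp" "\<psi> \<in> finsupp" "z \<in> \<Omega>"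
  shows "eval (\<phi> + \<psi>) z = eval \<phi> z + eval \<psi> z"
proof -
  let ?S = "{z. \<phi> z \<noteq> 0} \<union> {z. \<psi> z \<noteq> 0}"
  have S: "finite ?S" "?S \<subseteq> \<Omega>" using finsuppD assms by auto
  have "eval (\<phi> + \<psi>) z = (\<Sum>w\<in>?S. K z w (\<phi> w + \<psi> w))"
    using eval_eq[OF finsupp_add[OF assms(1,2)] assms(3) S support_add] by (simp only: plus_fun_def)
  also have "\<dots> = (\<Sum>w\<in>?S. K z w (\<phi> w) + K z w (\<psi> w))"
    using S assms by (intro sum.cong refl K_add) (auto dest: finsuppD)
  also have "\<dots> = eval \<phi> z + eval \<psi> z"
    using eval_eq[OF assms(1,3) S] eval_eq[OF assms(2,3) S] by (simp add: sum.distrib)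
  finally show ?thesis .
qed

lemma eval_scale:
  assumes "\<phi> \<in> finsupp" "z \<in> \<Omega>"
  shows "eval (pointwise_scale F c \<phi>) z = hscale F c (eval \<phi> z)"
proof -
  let ?S = "{z. \<phi> z \<noteq> 0}"
  have S: "finite ?S" "?S \<subseteq> \<Omega>" using finsuppD assms by auto
  have "eval (pointwise_scale F c \<phi>) z = (\<Sum>w\<in>?S. K z w (hscale F c (\<phi> w)))"
    using eval_eq[OF finsupp_scale[OF assms(1)] assms(2) S, of c] by (auto simp: pointwise_scale_def)
  also have "\<dots> = (\<Sum>w\<in>?S. hscale F c (K z w (\<phi> w)))"
    using S assms by (intro sum.cong refl K_scale) (auto dest: finsuppD)
  also have "\<dots> = hscale F c (eval \<phi> z)"
    by (simp add: eval_def F.vs.scale_sum_right)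
  finally show ?thesis .
qed

lemma form_add_left:
  assumes "\<phi> \<in> finsupp" "\<psi> \<in> finsupp" "\<theta> \<in> finsupp"
  shows "form (\<phi> + \<psi>) \<theta> = form \<phi> \<theta> + form \<psi> \<theta>"
  using assms finsuppD[OF assms(3)]
  by (simp add: form_eval[of _ \<theta> "{z. \<theta> z \<noteq> 0}"] finsupp_add subset_iff
      eval_add eval_mem F.inner_add_left sum.distrib)

lemma form_scale_left:
  assumes "\<phi> \<in> finsupp" "\<theta> \<in> finsupp"
  shows "form (pointwise_scale F c \<phi>) \<theta> = c * form \<phi> \<theta>"
  using assms finsuppD[OF assms(2)]
  by (simp add: form_eval[of _ \<theta> "{z. \<theta> z \<noteq> 0}"] finsupp_scale subset_iff
      eval_scale eval_mem F.inner_scale_left sum_distrib_left)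

lemma form_add_right:
  assumes "\<phi> \<in> finsupp" "\<psi> \<in> finsupp" "\<theta> \<in> finsupp"
  shows "form \<theta> (\<phi> + \<psi>) = form \<theta> \<phi> + form \<theta> \<psi>"
proof -
  let ?S = "{z. \<phi> z \<noteq> 0} \<union> {z. \<psi> z \<noteq> 0}"
  have S: "finite ?S" "?S \<subseteq> \<Omega>" using finsuppD assms by auto
  have "form \<theta> (\<phi> + \<psi>) = (\<Sum>w\<in>?S. hinner F (eval \<theta> w) (\<phi> w + \<psi> w))"
    using form_eval[OF assms(3) finsupp_add[OF assms(1,2)] S support_add] by (simp only: plus_fun_def)
  also have "\<dots> = (\<Sum>w\<in>?S. hinner F (eval \<theta> w) (\<phi> w) + hinner F (eval \<theta> w) (\<psi> w))"
    using S assms by (intro sum.cong refl F.inner_add_right eval_mem) (auto dest: finsuppD)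
  also have "\<dots> = form \<theta> \<phi> + form \<theta> \<psi>"
    using form_eval[OF assms(3) assms(1) S] form_eval[OF assms(3) assms(2) S]
    by (simp add: sum.distrib)
  finally show ?thesis .
qed

lemma form_scale_right:
  assumes "\<phi> \<in> finsupp" "\<theta> \<in> finsupp"
  shows "form \<theta> (pointwise_scale F c \<phi>) = cnj c * form \<theta> \<phi>"
proof -
  let ?S = "{z. \<phi> z \<noteq> 0}"
  have S: "finite ?S" "?S \<subseteq> \<Omega>" using finsuppD assms by auto
  have "form \<theta> (pointwise_scale F c \<phi>) = (\<Sum>w\<in>?S. hinner F (eval \<theta> w) (hscale F c (\<phi> w)))"
    using form_eval[OF assms(2) finsupp_scale[OF assms(1)] S, of c] by (auto simp: pointwise_scale_def)
  also have "\<dots> = (\<Sum>w\<in>?S. cnj c * hinner F (eval \<theta> w) (\<phi> w))"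
    using S assms by (intro sum.cong refl F.inner_scale_right eval_mem) (auto dest: finsuppD)
  also have "\<dots> = cnj c * form \<theta> \<phi>"
    using form_eval[OF assms(2) assms(1) S] by (simp add: sum_distrib_left)
  finally show ?thesis .
qed

text \<open>Enumerating the support turns \<open>form\<close> into one of the sums in
  \<open>is_kernel\<close>. Those sums have at least one term, so the empty support is a separate
  case.\<close>

lemma form_nonneg:
  assumes "\<phi> \<in> finsupp"
  shows "form \<phi> \<phi> \<in> \<real>\<^sub>\<ge>\<^sub>0"
proof (cases "{z. \<phi> z \<noteq> 0} = {}")
  case True
  then show ?thesis unfolding form_def True by simp
next
  case False
  let ?S = "{z. \<phi> z \<noteq> 0}"
  obtain h where h: "bij_betw h {..<card ?S} ?S"
    using ex_bij_betw_nat_finite[OF finsuppD(1)[OF assms]] by (auto simp: lessThan_atLeast0)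
  have "1 \<le> card ?S" using False finsuppD(1)[OF assms] by (simp add: Suc_le_eq card_gt_0_iff)
  moreover have "h i \<in> \<Omega> \<and> \<phi> (h i) \<in> hcarrier F" if "i < card ?S" for i
    using bij_betwE[OF h] finsuppD[OF assms] that by blast
  ultimately have
    "(\<Sum>i<card ?S. \<Sum>j<card ?S. hinner F (K (h i) (h j) (\<phi> (h j))) (\<phi> (h i))) \<in> \<real>\<^sub>\<ge>\<^sub>0"
    using kernel unfolding is_kernel_def
    by (elim conjE allE[of _ "card ?S"] impE allE[of _ h] allE[of _ "\<lambda>i. \<phi> (h i)"]) auto
  moreover have "form \<phi> \<phi> = (\<Sum>i<card ?S. \<Sum>j<card ?S. hinner F (K (h i) (h j) (\<phi> (h j))) (\<phi> (h i)))"
    unfolding form_def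
    by (subst sum.swap) (simp add: sum.reindex_bij_betw[OF h, symmetric])
  ultimately show ?thesis by simp
qed

text \<open>\<open>is_kernel\<close> asks for nonnegativity but says nothing about Hermitian
  symmetry. Over the complex numbers the symmetry follows by polarisation: that the form is real at
  \<open>\<phi> + \<psi>\<close> settles the imaginary parts, and that it is real at
  \<open>\<phi>\<close> plus i times \<open>\<psi>\<close> settles the real parts.\<close>

lemma form_commute:
  assumes "\<phi> \<in> finsupp" "\<psi> \<in> finsupp"
  shows "form \<psi> \<phi> = cnj (form \<phi> \<psi>)"
proof -
  have real: "Im (form \<theta> \<theta>) = 0" if "\<theta> \<in> finsupp" for \<theta>
    using form_nonneg[OF that] by (auto elim!: nonneg_Reals_cases)
  have "Im (form (\<phi> + \<psi>) (\<phi> + \<psi>)) = Im (form \<phi> \<psi> + form \<psi> \<phi>)"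
    using assms by (simp add: form_add_left form_add_right finsupp_add real)
  moreover have "Im (form (\<phi> + pointwise_scale F \<i> \<psi>) (\<phi> + pointwise_scale F \<i> \<psi>))
      = Re (form \<psi> \<phi>) - Re (form \<phi> \<psi>)"
    using assms by (simp add: form_add_left form_add_right form_scale_left form_scale_right
        finsupp_add finsupp_scale real)
  ultimately show ?thesis
    using assms by (simp add: real finsupp_add finsupp_scale complex_eq_iff)
qed

lemma vector_space_pointwise: "vector_space (pointwise_scale F :: complex \<Rightarrow> ('z \<Rightarrow> 'a) \<Rightarrow> _)"
  by unfold_locales (auto simp: pointwise_scale_def fun_eq_iff F.vs.scale_right_distrib
      F.vs.scale_left_distrib)

sublocale V: semi_hilbert formal_space
proof (rule semi_hilbert.intro)
  interpret P: vector_space "pointwise_scale F :: complex \<Rightarrow> ('z \<Rightarrow> 'a) \<Rightarrow> _"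
    by (rule vector_space_pointwise)
  show "module.subspace (hscale formal_space) (hcarrier formal_space)"
    unfolding formal_space_sel
    by (rule P.subspaceI) (simp_all add: finsupp_add finsupp_scale, simp add: finsupp_def image_subset_iff F.zero_mem)
  show "hinner formal_space y x = cnj (hinner formal_space x y)"
    if "x \<in> hcarrier formal_space" "y \<in> hcarrier formal_space" for x y
    using that unfolding formal_space_sel by (rule form_commute)
qed (simp_all add: formal_space_sel vector_space_pointwise form_add_left form_scale_left
    form_nonneg)

lemma eval_diff:
  assumes "\<phi> \<in> finsupp" "\<psi> \<in> finsupp" "z \<in> \<Omega>"
  shows "eval (\<phi> - \<psi>) z = eval \<phi> z - eval \<psi> z"
  using eval_add[of "\<phi> - \<psi>" \<psi> z] V.diff_mem assms by (simp add: formal_space_sel)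

text \<open>The kernel function at z with vector x has squared norm equal to the inner product of
  K(z,z)x with x. Pairing \<open>\<phi>\<close> with the kernel function whose vector is the value
  \<open>eval \<phi> z\<close> itself then bounds that value.\<close>

lemma hnorm_eval_le:
  assumes "z \<in> \<Omega>"
  shows "\<exists>C. \<forall>\<phi>\<in>finsupp. hnorm F (eval \<phi> z) \<le> C * hnorm formal_space \<phi>"
proof -
  obtain M where M: "\<And>x. x \<in> hcarrier F \<Longrightarrow> hnorm F (K z z x) \<le> M * hnorm F x"
    using K_op[OF assms assms] unfolding bounded_op_def by blast
  \<comment> \<open>The constant in \<open>bounded_op\<close> carries no sign condition, hence the
    absolute value under the root.\<close>
  have single: "hnorm formal_space (single z x) \<le> sqrt \<bar>M\<bar> * hnorm F x" if x: "x \<in> hcarrier F" for x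
  proof -
    have "(hnorm formal_space (single z x))\<^sup>2 = Re (hinner F (K z z x) x)"
      using x assms by (simp add: V.hnorm_power2 formal_space_sel single_finsupp form_single eval_single)
    also have "\<dots> \<le> hnorm F (K z z x) * hnorm F x"
      using F.cauchy_schwarz[of "K z z x" x] K_mem x assms complex_Re_le_cmod order_trans by blast
    also have "\<dots> \<le> (\<bar>M\<bar> * hnorm F x) * hnorm F x"
      using M[OF x] F.hnorm_nonneg[OF x] by (smt (verit) mult_right_mono)
    also have "\<dots> = (sqrt \<bar>M\<bar> * hnorm F x)\<^sup>2"
      by (simp add: power_mult_distrib) (simp add: power2_eq_square)
    finally show ?thesis
      by (rule power2_le_imp_le) (simp add: F.hnorm_nonneg x)
  qed
  have "hnorm F (eval \<phi> z) \<le> sqrt \<bar>M\<bar> * hnorm formal_space \<phi>" if \<phi>: "\<phi> \<in> finsupp" for \<phi>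
  proof -
    let ?y = "eval \<phi> z"
    have y: "?y \<in> hcarrier F" using \<phi> assms by (rule eval_mem)
    have pos: "0 \<le> hnorm formal_space \<phi>" using V.hnorm_nonneg \<phi> by (simp add: formal_space_sel)
    have "(hnorm F ?y)\<^sup>2 = Re (form \<phi> (single z ?y))"
      using \<phi> assms y by (simp add: form_single F.hnorm_power2)
    also have "\<dots> \<le> hnorm formal_space \<phi> * hnorm formal_space (single z ?y)"
      using V.cauchy_schwarz[of \<phi> "single z ?y"] single_finsupp[OF assms y] \<phi> complex_Re_le_cmod
        order_trans by (simp add: formal_space_sel) blast
    also have "\<dots> \<le> hnorm formal_space \<phi> * (sqrt \<bar>M\<bar> * hnorm F ?y)"
      using single[OF y] pos by (rule mult_left_mono)
    finally have "hnorm F ?y * hnorm F ?y \<le> (sqrt \<bar>M\<bar> * hnorm formal_space \<phi>) * hnorm F ?y"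
      by (simp add: power2_eq_square mult_ac)
    then show ?thesis
      using F.hnorm_nonneg[OF y] pos by (cases "hnorm F ?y = 0") auto
  qed
  then show ?thesis by blast
qed

text \<open>Elements of the completion become genuine functions, namely pointwise limits of values.
  Prescribing 0 off \<open>\<Omega>\<close> makes vanishing on \<open>\<Omega>\<close> the same as
  being the zero of the function type.\<close>

definition represents :: "(nat \<Rightarrow> 'z \<Rightarrow> 'a) \<Rightarrow> ('z \<Rightarrow> 'a) \<Rightarrow> bool" where
  "represents s f \<longleftrightarrow>
     (\<forall>z\<in>\<Omega>. f z \<in> hcarrier F \<and> (\<lambda>n. hnorm F (eval (s n) z - f z)) \<longlonglongrightarrow> 0) \<and> (\<forall>z. z \<notin> \<Omega> \<longrightarrow> f z = 0)"

lemma cauchy_finsupp: "V.cauchy s \<Longrightarrow> s n \<in> finsupp"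
  using V.cauchy_mem by (simp add: formal_space_sel)

text \<open>Pointwise limits exist because evaluation is bounded and \<open>F\<close> is complete.
  The substantial point is that a Cauchy sequence whose values tend to 0 at every point is null in
  the seminorm; without it, distinct elements of the abstract completion could give the same
  function.\<close>

sublocale completion: hilbert_completion formal_space "pointwise_scale F" represents
proof (rule hilbert_completion.intro[OF V.semi_hilbert_axioms], rule hilbert_completion_axioms.intro)
  fix s t f g assume s: "V.cauchy s" "represents s f" and t: "V.cauchy t" "represents t g"
  show "represents (\<lambda>n. s n + t n) (f + g)"
    unfolding represents_def
  proof (intro conjI ballI allI impI)
    fix z assume z: "z \<in> \<Omega>"
    show "(f + g) z \<in> hcarrier F" using s t z by (simp add: represents_def F.mem)
    have "(\<lambda>n. hnorm F (eval (s n) z - f z) + hnorm F (eval (t n) z - g z)) \<longlonglongrightarrow> 0"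
      using s t z by (intro tendsto_add_zero) (auto simp: represents_def)
    moreover have "norm (hnorm F (eval (s n + t n) z - (f + g) z))
        \<le> hnorm F (eval (s n) z - f z) + hnorm F (eval (t n) z - g z)" for n
    proof -
      have memb: "eval (s n) z \<in> hcarrier F" "eval (t n) z \<in> hcarrier F" "f z \<in> hcarrier F" "g z \<in> hcarrier F"
        using s t z by (auto simp: represents_def eval_mem cauchy_finsupp)
      have "eval (s n + t n) z - (f + g) z = (eval (s n) z - f z) + (eval (t n) z - g z)"
        using s t z by (simp add: eval_add cauchy_finsupp)
      then show ?thesis
        using F.hnorm_triangle[OF F.diff_mem[OF memb(1,3)] F.diff_mem[OF memb(2,4)]]
          F.hnorm_nonneg[OF F.add_mem[OF F.diff_mem[OF memb(1,3)] F.diff_mem[OF memb(2,4)]]]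
        by (simp only: real_norm_def abs_of_nonneg)
    qed
    ultimately show "(\<lambda>n. hnorm F (eval (s n + t n) z - (f + g) z)) \<longlonglongrightarrow> 0"
      by (rule seq_null_comparison)
  qed (use s t in \<open>simp add: represents_def\<close>)
next
  fix s f c assume s: "V.cauchy s" "represents s f"
  have "(\<lambda>n. hnorm F (eval (pointwise_scale F c (s n)) z - hscale F c (f z))) \<longlonglongrightarrow> 0" if z: "z \<in> \<Omega>" for z
  proof -
    have "(\<lambda>n. cmod c * hnorm F (eval (s n) z - f z)) \<longlonglongrightarrow> cmod c * 0"
      using s z by (intro tendsto_mult_left) (simp add: represents_def)
    moreover have "hnorm F (eval (pointwise_scale F c (s n)) z - hscale F c (f z))
        = cmod c * hnorm F (eval (s n) z - f z)" for n
      using s z by (simp add: eval_scale cauchy_finsupp F.hnorm_scale F.mem represents_def eval_mem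
          flip: F.vs.scale_right_diff_distrib)
    ultimately show ?thesis by simp
  qed
  then show "represents (\<lambda>n. hscale formal_space c (s n)) (pointwise_scale F c f)"
    using s by (auto simp: represents_def formal_space_sel F.mem)
      (simp_all add: pointwise_scale_def F.mem)
next
  fix s assume s: "V.cauchy s"
  have "\<exists>y\<in>hcarrier F. (\<lambda>n. hnorm F (eval (s n) z - y)) \<longlonglongrightarrow> 0" if z: "z \<in> \<Omega>" for z
  proof (rule F.complete)
    show "eval (s n) z \<in> hcarrier F" for n using s z by (simp add: eval_mem cauchy_finsupp)
    fix e :: real assume "e > 0"
    obtain C where C: "\<And>\<phi>. \<phi> \<in> finsupp \<Longrightarrow> hnorm F (eval \<phi> z) \<le> C * hnorm formal_space \<phi>"
      using hnorm_eval_le[OF z] by blast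
    have pos: "0 < \<bar>C\<bar> + 1" by simp
    then obtain N where N: "\<forall>m\<ge>N. \<forall>n\<ge>N. hnorm formal_space (s m - s n) < e / (\<bar>C\<bar> + 1)"
      using s \<open>e > 0\<close> unfolding V.cauchy_def by (meson divide_pos_pos)
    have "hnorm F (eval (s m) z - eval (s n) z) < e" if "m \<ge> N" "n \<ge> N" for m n
    proof -
      have d: "s m - s n \<in> finsupp" using V.diff_mem V.cauchy_mem[OF s] by (simp add: formal_space_sel)
      have "hnorm F (eval (s m) z - eval (s n) z) \<le> C * hnorm formal_space (s m - s n)"
        using C[OF d] s z by (simp add: eval_diff cauchy_finsupp)
      also have "\<dots> \<le> (\<bar>C\<bar> + 1) * hnorm formal_space (s m - s n)"
        using V.hnorm_nonneg d by (intro mult_right_mono) (auto simp: formal_space_sel)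
      also have "\<dots> < e"
        using N that pos by (simp add: pos_less_divide_eq mult.commute)
      finally show ?thesis .
    qed
    then show "\<exists>N. \<forall>m\<ge>N. \<forall>n\<ge>N. hnorm F (eval (s m) z - eval (s n) z) < e" by blast
  qed
  then obtain y where "\<And>z. z \<in> \<Omega> \<Longrightarrow> y z \<in> hcarrier F \<and> (\<lambda>n. hnorm F (eval (s n) z - y z)) \<longlonglongrightarrow> 0"
    by metis
  then have "represents s (\<lambda>z. if z \<in> \<Omega> then y z else 0)" by (simp add: represents_def)
  then show "\<exists>f. represents s f" by blast
next
  fix s f assume s: "V.cauchy s" "represents s f"
  have fm: "s n \<in> finsupp" for n using s(1) by (rule cauchy_finsupp)
  show "f = 0 \<longleftrightarrow> (\<lambda>n. hnorm formal_space (s n)) \<longlonglongrightarrow> 0"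
  proof
    assume 0: "f = 0"
    \<comment> \<open>A fixed finitely supported \<open>\<psi>\<close> sees only finitely many
      values, so pointwise convergence gives weak convergence.\<close>
    have weak: "(\<lambda>n. form (s n) \<psi>) \<longlonglongrightarrow> 0" if \<psi>: "\<psi> \<in> finsupp" for \<psi>
    proof -
      have "(\<lambda>n. \<Sum>w | \<psi> w \<noteq> 0. hinner F (eval (s n) w) (\<psi> w)) \<longlonglongrightarrow> (\<Sum>w | \<psi> w \<noteq> 0. hinner F 0 (\<psi> w))"
        using s(2) 0 finsuppD[OF \<psi>] fm
        by (intro tendsto_sum F.tendsto_inner_left) (auto simp: represents_def eval_mem F.zero_mem)
      then show ?thesis
        using form_eval[OF fm \<psi>, of "{w. \<psi> w \<noteq> 0}"] finsuppD[OF \<psi>] by (simp add: F.inner_zero_left)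
    qed
    show "(\<lambda>n. hnorm formal_space (s n)) \<longlonglongrightarrow> 0"
    proof (rule LIMSEQ_I)
      fix e :: real assume e: "e > 0"
      obtain B where B: "B > 0" "\<And>n. hnorm formal_space (s n) \<le> B" using V.cauchy_bounded[OF s(1)] by blast
      obtain N where N: "\<forall>m\<ge>N. \<forall>n\<ge>N. hnorm formal_space (s m - s n) < e\<^sup>2 / (2 * B)"
        using s(1) e B(1) unfolding V.cauchy_def
        by (meson divide_pos_pos mult_pos_pos zero_less_numeral zero_less_power)
      obtain M where M: "\<forall>n\<ge>M. cmod (form (s n) (s N)) < e\<^sup>2 / 2"
        using LIMSEQ_D[OF weak[OF fm[of N]], of "e\<^sup>2 / 2"] e by auto
      have "norm (hnorm formal_space (s n) - 0) < e" if n: "n \<ge> max M N" for n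
      proof -
        have memb: "s n \<in> hcarrier formal_space" "s N \<in> hcarrier formal_space" "s n - s N \<in> hcarrier formal_space"
          using V.cauchy_mem[OF s(1)] V.diff_mem by auto
        \<comment> \<open>The term with \<open>s n - s N\<close> is small by the Cauchy property and
          the bound \<open>B\<close>; the term with the fixed vector \<open>s N\<close> is small by
          weak convergence.\<close>
        have "(hnorm formal_space (s n))\<^sup>2 = Re (form (s n) (s n - s N)) + Re (form (s n) (s N))"
          using V.inner_diff_right[OF memb(1,2,1)] memb V.hnorm_power2[OF memb(1)] by (simp add: formal_space_sel)
        also have "\<dots> \<le> cmod (form (s n) (s n - s N)) + cmod (form (s n) (s N))"
          by (intro add_mono complex_Re_le_cmod)
        also have "cmod (form (s n) (s n - s N)) \<le> hnorm formal_space (s n) * hnorm formal_space (s n - s N)"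
          using V.cauchy_schwarz[OF memb(1,3)] by (simp add: formal_space_sel)
        also have "\<dots> \<le> B * hnorm formal_space (s n - s N)"
          using B(2) V.hnorm_nonneg memb by (intro mult_right_mono)
        also have "\<dots> < e\<^sup>2 / 2"
          using N[rule_format, of n N] n B(1) by (simp add: field_simps)
        also have "cmod (form (s n) (s N)) < e\<^sup>2 / 2" using M n by simp
        finally have "(hnorm formal_space (s n))\<^sup>2 < e\<^sup>2" by simp
        then have "hnorm formal_space (s n) < e"
          by (rule power2_less_imp_less) (use e in simp)
        then show ?thesis using V.hnorm_nonneg[OF memb(1)] by simp
      qed
      then show "\<exists>N. \<forall>n\<ge>N. norm (hnorm formal_space (s n) - 0) < e" by blast
    qed
  next
    assume null: "(\<lambda>n. hnorm formal_space (s n)) \<longlonglongrightarrow> 0"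
    have "f z = 0" if z: "z \<in> \<Omega>" for z
    proof -
      obtain C where C: "\<And>\<phi>. \<phi> \<in> finsupp \<Longrightarrow> hnorm F (eval \<phi> z) \<le> C * hnorm formal_space \<phi>"
        using hnorm_eval_le[OF z] by blast
      have "(\<lambda>n. C * hnorm formal_space (s n)) \<longlonglongrightarrow> 0"
        using null by (rule tendsto_mult_right_zero)
      moreover have "norm (hnorm F (eval (s n) z - 0)) \<le> C * hnorm formal_space (s n)" for n
        using C[OF fm] F.hnorm_nonneg[OF eval_mem[OF fm z]] by simp
      ultimately have "(\<lambda>n. hnorm F (eval (s n) z - 0)) \<longlonglongrightarrow> 0"
        by (rule seq_null_comparison)
      then show ?thesis
        using F.limit_unique[of "\<lambda>n. eval (s n) z" "f z" 0] s(2) z eval_mem[OF fm z] F.zero_mem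
        by (simp add: represents_def)
    qed
    then show "f = 0" using s(2) by (auto simp: represents_def fun_eq_iff)
  qed
qed (rule vector_space_pointwise)

end

text \<open>A predicate, so that an existence theorem can deliver the space and its kernel functions
  together. The scalar multiplication is prescribed because evaluation at a point has to be linear;
  addition is already pointwise in the function type.\<close>

definition reproducing ::
  "'z set \<Rightarrow> 'a::ab_group_add hilbert \<Rightarrow> ('z \<Rightarrow> 'z \<Rightarrow> 'a \<Rightarrow> 'a) \<Rightarrow> ('z \<Rightarrow> 'a) hilbert
    \<Rightarrow> ('z \<Rightarrow> 'a \<Rightarrow> 'z \<Rightarrow> 'a) \<Rightarrow> bool" where
  "reproducing \<Omega> F K E k \<longleftrightarrow> complex_hilbert E \<and> hscale E = pointwise_scale F \<and>
     (\<forall>f\<in>hcarrier E. \<forall>z\<in>\<Omega>. f z \<in> hcarrier F) \<and>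
     (\<forall>z\<in>\<Omega>. \<forall>\<eta>\<in>hcarrier F. k z \<eta> \<in> hcarrier E \<and> (\<forall>w\<in>\<Omega>. k z \<eta> w = K w z \<eta>) \<and>
        (\<forall>f\<in>hcarrier E. hinner E f (k z \<eta>) = hinner F (f z) \<eta>))"

theorem reproducing_kernel_hilbert_space:
  fixes F :: "'a::ab_group_add hilbert" and K :: "'z \<Rightarrow> 'z \<Rightarrow> 'a \<Rightarrow> 'a"
  assumes "complex_hilbert F" and "is_kernel \<Omega> F K"
  shows "\<exists>E k. reproducing \<Omega> F K E k"
proof -
  interpret complex_hilbert F by fact
  interpret operator_kernel F \<Omega> K by unfold_locales fact
  let ?k = "\<lambda>z \<eta> w. if w \<in> \<Omega> then K w z \<eta> else 0"
  have k: "represents (\<lambda>_. single z \<eta>) (?k z \<eta>)" if "z \<in> \<Omega>" "\<eta> \<in> hcarrier F" for z \<eta>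
    using that by (simp add: represents_def eval_single K_mem hnorm_zero)
  have c: "V.cauchy (\<lambda>_. single z \<eta>)" if "z \<in> \<Omega>" "\<eta> \<in> hcarrier F" for z \<eta>
    using that by (intro V.cauchy_const) (simp add: formal_space_sel single_finsupp)
  have "hinner completion.completion f (?k z \<eta>) = hinner F (f z) \<eta>"
    if f: "f \<in> completion.carr" and z: "z \<in> \<Omega>" "\<eta> \<in> hcarrier F" for f z \<eta>
  proof -
    obtain s where s: "V.cauchy s" "represents s f" using f by (rule completion.carrE)
    have "(\<lambda>n. form (s n) (single z \<eta>)) \<longlonglongrightarrow> hinner completion.completion f (?k z \<eta>)"
      using completion.tendsto_inner_completion[OF s c[OF z] k[OF z]] by (simp add: formal_space_sel)
    moreover have "(\<lambda>n. hinner F (eval (s n) z) \<eta>) \<longlonglongrightarrow> hinner F (f z) \<eta>"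
      using s z by (intro tendsto_inner_left) (auto simp: represents_def eval_mem cauchy_finsupp)
    ultimately show ?thesis
      using LIMSEQ_unique by (simp add: form_single cauchy_finsupp s z)
  qed
  moreover have "?k z \<eta> \<in> completion.carr" if "z \<in> \<Omega>" "\<eta> \<in> hcarrier F" for z \<eta>
    using completion.carrI c k that by blast
  moreover have "f z \<in> hcarrier F" if "f \<in> completion.carr" "z \<in> \<Omega>" for f z
    using that by (auto elim!: completion.carrE simp: represents_def)
  ultimately have "reproducing \<Omega> F K completion.completion ?k"
    by (simp add: reproducing_def completion.completion_hilbert completion.sel)
  then show ?thesis by blast
qed

section \<open>Schur functions\<close>

text \<open>A real supremum is informative only over a nonempty set that is bounded above, so even
  the lower bound relies on \<open>B\<close>. The zero vector supplies nonemptiness and a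
  nonnegative member.\<close>

lemma op_norm_bounds:
  assumes E: "semi_hilbert E" and F: "semi_hilbert F"
    and mem: "\<And>x. x \<in> hcarrier E \<Longrightarrow> T x \<in> hcarrier F"
    and le: "\<And>x. x \<in> hcarrier E \<Longrightarrow> hnorm F (T x) \<le> B * hnorm E x" and "B \<ge> 0"
  shows "0 \<le> op_norm E F T" "op_norm E F T \<le> B"
proof -
  interpret E: semi_hilbert E by fact
  interpret F: semi_hilbert F by fact
  let ?S = "{x \<in> hcarrier E. hnorm E x \<le> 1}"
  have 0: "0 \<in> ?S" by (simp add: E.zero_mem E.hnorm_zero)
  have bd: "hnorm F (T x) \<le> B" if "x \<in> ?S" for x
    using le[of x] that mult_left_mono[of "hnorm E x" 1 B] \<open>B \<ge> 0\<close> by auto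
  show "op_norm E F T \<le> B"
    unfolding op_norm_def using 0 bd by (intro cSUP_least) auto
  have "0 \<le> hnorm F (T 0)" using mem E.zero_mem F.hnorm_nonneg by blast
  also have "\<dots> \<le> op_norm E F T"
    unfolding op_norm_def using 0 bd by (intro cSUP_upper bdd_aboveI2)
  finally show "0 \<le> op_norm E F T" .
qed

lemma adj_eqI:
  assumes "complex_hilbert E" "x \<in> hcarrier E"
    and "\<And>u. u \<in> hcarrier E \<Longrightarrow> hinner F (T u) y = hinner E u x"
  shows "adj E F T y = x"
  unfolding adj_def
proof (rule the_equality)
  interpret E: complex_hilbert E by fact
  show "x' = x" if "x' \<in> hcarrier E \<and> (\<forall>u\<in>hcarrier E. hinner F (T u) y = hinner E u x')" for x'
    using that assms E.eqI_inner by metis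
qed (use assms in blast)

text \<open>\<open>adj\<close> is a definite description. Riesz representation provides a candidate
  and \<open>adj_eqI\<close> its uniqueness, so \<open>adj\<close> denotes the usual
  adjoint.\<close>

lemma
  assumes "complex_hilbert E" "semi_hilbert F" "T \<in> bounded_op E F" "y \<in> hcarrier F"
  shows adj_mem: "adj E F T y \<in> hcarrier E"
    and inner_adj: "\<And>u. u \<in> hcarrier E \<Longrightarrow> hinner F (T u) y = hinner E u (adj E F T y)"
proof -
  interpret E: complex_hilbert E by fact
  interpret F: semi_hilbert F by fact
  obtain B where B: "\<And>x. x \<in> hcarrier E \<Longrightarrow> hnorm F (T x) \<le> B * hnorm E x"
    using assms(3) unfolding bounded_op_def by blast
  have T: "T x \<in> hcarrier F" "x' \<in> hcarrier E \<Longrightarrow> T (x + x') = T x + T x'"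
    "T (hscale E c x) = hscale F c (T x)" if "x \<in> hcarrier E" for x x' c
    using assms(3) that by (auto simp: bounded_op_def)
  have "\<exists>l\<in>hcarrier E. \<forall>u\<in>hcarrier E. hinner F (T u) y = hinner E u l"
  proof (rule E.riesz)
    fix x assume x: "x \<in> hcarrier E"
    have "cmod (hinner F (T x) y) \<le> hnorm F (T x) * hnorm F y"
      using F.cauchy_schwarz T(1) x assms(4) by blast
    also have "\<dots> \<le> (B * hnorm E x) * hnorm F y"
      using B x F.hnorm_nonneg assms(4) by (intro mult_right_mono)
    finally show "cmod (hinner F (T x) y) \<le> (B * hnorm F y) * hnorm E x" by (simp add: mult_ac)
  qed (use T assms(4) in \<open>simp_all add: F.inner_add_left F.inner_scale_left\<close>)
  then show "adj E F T y \<in> hcarrier E"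
    "\<And>u. u \<in> hcarrier E \<Longrightarrow> hinner F (T u) y = hinner E u (adj E F T y)"
    using adj_eqI[OF assms(1), of _ F T y] by metis+
qed

section \<open>Necessity: positivity of the defect kernel\<close>

lemma one_minus_mult_cnj_nonzero:
  assumes "z \<in> ball 0 1" "w \<in> ball 0 1"
  shows "1 - z * cnj w \<noteq> 0"
proof
  assume "1 - z * cnj w = 0"
  then have "cmod z * cmod w = 1" by (metis complex_mod_cnj eq_iff_diff_eq_0 norm_mult norm_one)
  then show False
    using assms mult_strict_mono'[of "cmod z" 1 "cmod w" 1] by simp
qed

text \<open>The kernel L of the overview.\<close>

definition defect :: "'a::ab_group_add hilbert \<Rightarrow> (complex \<Rightarrow> complex \<Rightarrow> 'a \<Rightarrow> 'a) \<Rightarrow>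
    complex \<Rightarrow> complex \<Rightarrow> 'a \<Rightarrow> 'a" where
  "defect F K z w x = x - hscale F (1 - z * cnj w) (K z w x)"

lemma defect_bounded_op:
  assumes "semi_hilbert F" "K z w \<in> bounded_op F F"
  shows "defect F K z w \<in> bounded_op F F"
proof -
  interpret F: semi_hilbert F by fact
  obtain B where B: "\<And>x. x \<in> hcarrier F \<Longrightarrow> hnorm F (K z w x) \<le> B * hnorm F x"
    using assms(2) unfolding bounded_op_def by blast
  have K: "K z w x \<in> hcarrier F" "y \<in> hcarrier F \<Longrightarrow> K z w (x + y) = K z w x + K z w y"
    "K z w (hscale F c x) = hscale F c (K z w x)" if "x \<in> hcarrier F" for x y c
    using assms(2) that by (auto simp: bounded_op_def)
  have "hnorm F (defect F K z w x) \<le> (1 + cmod (1 - z * cnj w) * B) * hnorm F x"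
    if x: "x \<in> hcarrier F" for x
  proof -
    have "hnorm F (defect F K z w x) \<le> hnorm F x + cmod (1 - z * cnj w) * hnorm F (K z w x)"
      unfolding defect_def using F.hnorm_diff_le[OF x F.scale_mem[OF K(1)[OF x]]] F.hnorm_scale[OF K(1)[OF x]]
      by metis
    also have "\<dots> \<le> hnorm F x + cmod (1 - z * cnj w) * (B * hnorm F x)"
      using B[OF x] by (intro add_left_mono mult_left_mono) auto
    finally show ?thesis by (simp add: algebra_simps)
  qed
  then show ?thesis
    unfolding bounded_op_def mem_Collect_eq
    by (intro conjI exI[of _ "1 + cmod (1 - z * cnj w) * B"])
      (auto simp: defect_def K F.mem F.vs.scale_right_distrib F.vs.scale_right_diff_distrib mult.commute)
qed

text \<open>The double sum is the inner product with itself of the sum over i of the adjoint of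
  \<open>\<Theta> (z i)\<close> applied to \<open>\<eta> i\<close>.\<close>

lemma schur_representation_imp_defect_kernel:
  assumes "complex_hilbert F" and K: "is_kernel (ball 0 1) F K" and "schur_representation E F K \<Theta>"
  shows "is_kernel (ball 0 1) F (defect F K)"
proof -
  interpret F: complex_hilbert F by fact
  interpret E: complex_hilbert E using assms(3) by (simp add: schur_representation_def)
  have \<Theta>: "\<Theta> z \<in> bounded_op E F" if "z \<in> ball 0 1" for z
    using assms(3) that by (auto simp: schur_representation_def schur_class_def op_analytic_on_def)
  define adjoint where "adjoint w = adj E F (\<Theta> w)" for w
  have adjoint: "adjoint w y \<in> hcarrier E"
    "u \<in> hcarrier E \<Longrightarrow> hinner F (\<Theta> w u) y = hinner E u (adjoint w y)"
    if "w \<in> ball 0 1" "y \<in> hcarrier F" for w y u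
    using adj_mem inner_adj E.complex_hilbert_axioms F.semi_hilbert_axioms \<Theta> that
    unfolding adjoint_def by blast+
  have defect: "defect F K z w x = \<Theta> z (adjoint w x)"
    if "z \<in> ball 0 1" "w \<in> ball 0 1" "x \<in> hcarrier F" for z w x
    using assms(3) one_minus_mult_cnj_nonzero[OF that(1,2)] that
    by (simp add: schur_representation_def defect_def adjoint_def del: mem_ball mem_ball_0)
  show ?thesis
    unfolding is_kernel_def
  proof (intro conjI ballI allI impI)
    show "defect F K z w \<in> bounded_op F F" if "z \<in> ball 0 1" "w \<in> ball 0 1" for z w
      using defect_bounded_op[of F K] F.semi_hilbert_axioms K that unfolding is_kernel_def by blast
  next
    fix m :: nat and z :: "nat \<Rightarrow> complex" and \<eta>
    assume z\<eta>: "\<forall>i<m. z i \<in> ball 0 1 \<and> \<eta> i \<in> hcarrier F"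
    define v where "v i = adjoint (z i) (\<eta> i)" for i
    have v: "v i \<in> hcarrier E" if "i < m" for i
      using adjoint(1) z\<eta> that by (simp add: v_def)
    have "(\<Sum>i<m. \<Sum>j<m. hinner F (defect F K (z i) (z j) (\<eta> j)) (\<eta> i))
        = (\<Sum>i<m. \<Sum>j<m. hinner E (v j) (v i))"
      using defect adjoint z\<eta> by (intro sum.cong refl) (auto simp: v_def)
    also have "\<dots> = hinner E (\<Sum>j<m. v j) (\<Sum>i<m. v i)"
      using v by (subst sum.swap) (simp add: E.inner_combination[of "{..<m}" v "\<lambda>_. 1", simplified])
    finally show "(\<Sum>i<m. \<Sum>j<m. hinner F (defect F K (z i) (z j) (\<eta> j)) (\<eta> i)) \<in> \<real>\<^sub>\<ge>\<^sub>0"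
      using E.inner_nonneg[OF E.sum_mem, of "{..<m}" v] v by simp
  qed
qed

section \<open>Sufficiency: the reproducing kernel spaces of \<open>K\<close> and of its
  defect\<close>

locale kernel_pair = F: complex_hilbert F
  for F :: "'a::ab_group_add hilbert" +
  fixes K :: "complex \<Rightarrow> complex \<Rightarrow> 'a \<Rightarrow> 'a"
    and H :: "(complex \<Rightarrow> 'a) hilbert" and k :: "complex \<Rightarrow> 'a \<Rightarrow> complex \<Rightarrow> 'a"
    and G :: "(complex \<Rightarrow> 'a) hilbert" and l :: "complex \<Rightarrow> 'a \<Rightarrow> complex \<Rightarrow> 'a"
  assumes reproducing_H: "reproducing (ball 0 1) F K H k"
    and reproducing_G: "reproducing (ball 0 1) F (defect F K) G l"
begin

sublocale H: complex_hilbert H using reproducing_H by (simp add: reproducing_def)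
sublocale G: complex_hilbert G using reproducing_G by (simp add: reproducing_def)

lemma
  assumes "z \<in> ball 0 1"
  shows H_value: "f \<in> hcarrier H \<Longrightarrow> f z \<in> hcarrier F"
    and G_value: "f \<in> hcarrier G \<Longrightarrow> f z \<in> hcarrier F"
  using assms reproducing_H reproducing_G by (auto simp: reproducing_def)

lemma
  assumes "z \<in> ball 0 1" "x \<in> hcarrier F"
  shows k_mem: "k z x \<in> hcarrier H" and l_mem: "l z x \<in> hcarrier G"
    and k_value: "w \<in> ball 0 1 \<Longrightarrow> k z x w = K w z x"
    and l_value: "w \<in> ball 0 1 \<Longrightarrow> l z x w = defect F K w z x"
    and inner_k: "f \<in> hcarrier H \<Longrightarrow> hinner H f (k z x) = hinner F (f z) x"
    and inner_l: "f \<in> hcarrier G \<Longrightarrow> hinner G f (l z x) = hinner F (f z) x"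
  using assms reproducing_H reproducing_G by (auto simp: reproducing_def simp del: mem_ball mem_ball_0)

lemma K_mem: "z \<in> ball 0 1 \<Longrightarrow> w \<in> ball 0 1 \<Longrightarrow> x \<in> hcarrier F \<Longrightarrow> K z w x \<in> hcarrier F"
  by (metis H_value k_mem k_value)

lemma inner_l_l:
  assumes "z \<in> ball 0 1" "w \<in> ball 0 1" "x \<in> hcarrier F"
  shows "hinner G (l w x) (l z x) = hinner F x x - (1 - z * cnj w) * hinner H (k w x) (k z x)"
  using assms by (simp add: inner_l l_mem l_value inner_k k_mem k_value defect_def K_mem
      F.inner_diff_left F.inner_scale_left F.mem del: mem_ball mem_ball_0)

text \<open>The diagonal case of \<open>inner_l_l\<close>. Both summands on the left are
  nonnegative: the first yields contractivity of evaluation on \<open>G\<close>, the second a bound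
  for the kernel functions of \<open>K\<close> that is locally uniform in z.\<close>

lemma hnorm_l_k:
  assumes "z \<in> ball 0 1" "x \<in> hcarrier F"
  shows "(hnorm G (l z x))\<^sup>2 + (1 - (cmod z)\<^sup>2) * (hnorm H (k z x))\<^sup>2 = (hnorm F x)\<^sup>2"
proof -
  have "hinner G (l z x) (l z x) = hinner F x x - (1 - of_real ((cmod z)\<^sup>2)) * hinner H (k z x) (k z x)"
    using inner_l_l[OF assms(1,1,2)] by (simp only: complex_norm_square)
  then have "of_real ((hnorm G (l z x))\<^sup>2) = (of_real ((hnorm F x)\<^sup>2
      - (1 - (cmod z)\<^sup>2) * (hnorm H (k z x))\<^sup>2) :: complex)"
    using assms by (simp add: G.inner_self H.inner_self F.inner_self l_mem k_mem del: mem_ball mem_ball_0)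
  then show ?thesis unfolding of_real_eq_iff by simp
qed

lemma hnorm_l_le: "z \<in> ball 0 1 \<Longrightarrow> x \<in> hcarrier F \<Longrightarrow> hnorm G (l z x) \<le> hnorm F x"
proof -
  assume *: "z \<in> ball 0 1" "x \<in> hcarrier F"
  then have "(cmod z)\<^sup>2 \<le> 1" by (simp add: abs_square_le_1)
  then have "0 \<le> (1 - (cmod z)\<^sup>2) * (hnorm H (k z x))\<^sup>2" by simp
  then have "(hnorm G (l z x))\<^sup>2 \<le> (hnorm F x)\<^sup>2"
    using hnorm_l_k[OF *] by linarith
  then show ?thesis using F.hnorm_nonneg[OF *(2)] power2_le_imp_le by blast
qed

lemma hnorm_k_le:
  assumes "cmod z \<le> r" "r < 1" "x \<in> hcarrier F"
  shows "hnorm H (k z x) \<le> hnorm F x / (1 - r)"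
proof -
  have z: "z \<in> ball 0 1" using assms by simp
  have r: "0 \<le> r" using assms(1) norm_ge_zero order_trans by blast
  \<comment> \<open>From (1 - r)^2 <= 1 - r^2. The resulting constant is cruder than the natural one
    but contains no square root.\<close>
  have "(1 - r)\<^sup>2 * (hnorm H (k z x))\<^sup>2 \<le> (1 - (cmod z)\<^sup>2) * (hnorm H (k z x))\<^sup>2"
  proof (rule mult_right_mono)
    have "(cmod z)\<^sup>2 \<le> r\<^sup>2" using assms by (intro power_mono) auto
    moreover have "r\<^sup>2 \<le> r" using r assms by (simp add: power2_eq_square mult_left_le)
    ultimately show "(1 - r)\<^sup>2 \<le> 1 - (cmod z)\<^sup>2" by (simp add: power2_diff)
  qed simp
  also have "\<dots> \<le> (hnorm F x)\<^sup>2" using hnorm_l_k[OF z assms(3)] by (smt (verit) zero_le_power2)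
  finally have "((1 - r) * hnorm H (k z x))\<^sup>2 \<le> (hnorm F x)\<^sup>2" by (simp add: power_mult_distrib)
  then have "(1 - r) * hnorm H (k z x) \<le> hnorm F x"
    using F.hnorm_nonneg[OF assms(3)] power2_le_imp_le by blast
  then show ?thesis using assms by (simp add: field_simps)
qed

section \<open>Norm estimates for combinations of kernel functions\<close>

definition comb_k :: "nat \<Rightarrow> (nat \<Rightarrow> complex) \<Rightarrow> 'a \<Rightarrow> (nat \<Rightarrow> complex) \<Rightarrow> complex \<Rightarrow> 'a" where
  "comb_k n p x c = (\<Sum>i<n. hscale H (c i) (k (p i) x))"

definition comb_l :: "nat \<Rightarrow> (nat \<Rightarrow> complex) \<Rightarrow> 'a \<Rightarrow> (nat \<Rightarrow> complex) \<Rightarrow> complex \<Rightarrow> 'a" where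
  "comb_l n p x c = (\<Sum>i<n. hscale G (c i) (l (p i) x))"

context
  fixes n :: nat and p :: "nat \<Rightarrow> complex" and x :: 'a
  assumes p: "\<And>i. i < n \<Longrightarrow> p i \<in> ball 0 1" and x: "x \<in> hcarrier F"
begin

lemma comb_mem: "comb_k n p x c \<in> hcarrier H" "comb_l n p x c \<in> hcarrier G"
  unfolding comb_k_def comb_l_def using p x
  by (auto intro!: H.mem G.mem k_mem l_mem simp del: mem_ball mem_ball_0)

lemma inner_comb_k: "hinner H (comb_k n p x c) (comb_k n p x c)
    = (\<Sum>i<n. \<Sum>j<n. c i * cnj (c j) * hinner H (k (p i) x) (k (p j) x))"
  unfolding comb_k_def by (intro H.inner_combination k_mem p x) simp

lemma inner_comb_l: "hinner G (comb_l n p x c) (comb_l n p x c)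
    = (\<Sum>i<n. \<Sum>j<n. c i * cnj (c j) * hinner G (l (p i) x) (l (p j) x))"
  unfolding comb_l_def by (intro G.inner_combination l_mem p x) simp

text \<open>The factor \<open>p j * cnj (p i)\<close> that \<open>inner_l_l\<close> leaves at the
  (i,j) entry of the Gram matrix of K splits over i and j, and is absorbed by replacing
  \<open>c i\<close> with \<open>c i * cnj (p i)\<close>.\<close>

lemma hnorm_comb: "(hnorm H (comb_k n p x c))\<^sup>2 + (hnorm G (comb_l n p x c))\<^sup>2
    = (cmod (\<Sum>i<n. c i))\<^sup>2 * (hnorm F x)\<^sup>2 + (hnorm H (comb_k n p x (\<lambda>i. c i * cnj (p i))))\<^sup>2"
proof -
  have "hinner H (comb_k n p x c) (comb_k n p x c) + hinner G (comb_l n p x c) (comb_l n p x c)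
      = (\<Sum>i<n. \<Sum>j<n. c i * cnj (c j) * hinner F x x
          + (c i * cnj (p i)) * cnj (c j * cnj (p j)) * hinner H (k (p i) x) (k (p j) x))"
    unfolding inner_comb_k inner_comb_l sum.distrib[symmetric]
    using p x by (intro sum.cong refl) (simp add: inner_l_l algebra_simps del: mem_ball mem_ball_0)
  also have "\<dots> = (\<Sum>i<n. \<Sum>j<n. c i * cnj (c j)) * hinner F x x
      + hinner H (comb_k n p x (\<lambda>i. c i * cnj (p i))) (comb_k n p x (\<lambda>i. c i * cnj (p i)))"
    unfolding inner_comb_k sum.distrib by (simp add: sum_distrib_right)
  also have "(\<Sum>i<n. \<Sum>j<n. c i * cnj (c j)) = (\<Sum>i<n. c i) * cnj (\<Sum>i<n. c i)"
    by (simp add: sum_product)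
  finally have "of_real ((hnorm H (comb_k n p x c))\<^sup>2 + (hnorm G (comb_l n p x c))\<^sup>2)
    = (of_real ((cmod (\<Sum>i<n. c i))\<^sup>2 * (hnorm F x)\<^sup>2
        + (hnorm H (comb_k n p x (\<lambda>i. c i * cnj (p i))))\<^sup>2) :: complex)"
    using x by (simp only: H.inner_self G.inner_self F.inner_self comb_mem of_real_add of_real_mult
        complex_norm_square[symmetric] of_real_power)
  then show ?thesis unfolding of_real_eq_iff .
qed

text \<open>Both norms are at most ?M + |a| ?k. For ?k this is an inequality in itself, solvable
  because |a| < 1; inserting the solution in the bound for ?l gives the same constant, as 1 + |a|/(1
  - |a|) = 1/(1 - |a|).\<close>

lemma hnorm_comb_le:
  assumes c: "(\<Sum>i<n. c i) = 0" and a: "cmod a < 1"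
  shows "hnorm H (comb_k n p x c) \<le> hnorm H (comb_k n p x (\<lambda>i. c i * cnj (p i - a))) / (1 - cmod a)"
    and "hnorm G (comb_l n p x c) \<le> hnorm H (comb_k n p x (\<lambda>i. c i * cnj (p i - a))) / (1 - cmod a)"
proof -
  let ?k = "hnorm H (comb_k n p x c)" and ?l = "hnorm G (comb_l n p x c)"
  let ?M = "hnorm H (comb_k n p x (\<lambda>i. c i * cnj (p i - a)))"
  have nn: "0 \<le> ?k" "0 \<le> ?l" "0 \<le> ?M" by (simp_all add: H.hnorm_nonneg G.hnorm_nonneg comb_mem)
  have "comb_k n p x (\<lambda>i. c i * cnj (p i))
      = comb_k n p x (\<lambda>i. c i * cnj (p i - a)) + hscale H (cnj a) (comb_k n p x c)"
    unfolding comb_k_def H.vs.scale_sum_right sum.distrib[symmetric]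
    by (intro sum.cong refl) (simp add: algebra_simps flip: H.vs.scale_left_distrib)
  then have "hnorm H (comb_k n p x (\<lambda>i. c i * cnj (p i))) \<le> ?M + cmod a * ?k"
    using H.hnorm_triangle[of "comb_k n p x (\<lambda>i. c i * cnj (p i - a))" "hscale H (cnj a) (comb_k n p x c)"]
    by (simp add: H.hnorm_scale H.mem comb_mem del: complex_cnj_diff)
  then have "(hnorm H (comb_k n p x (\<lambda>i. c i * cnj (p i))))\<^sup>2 \<le> (?M + cmod a * ?k)\<^sup>2"
    using H.hnorm_nonneg[OF comb_mem(1)] by (intro power_mono)
  then have "?k\<^sup>2 + ?l\<^sup>2 \<le> (?M + cmod a * ?k)\<^sup>2"
    using hnorm_comb[of c] c by simp
  then have "?k\<^sup>2 \<le> (?M + cmod a * ?k)\<^sup>2" "?l\<^sup>2 \<le> (?M + cmod a * ?k)\<^sup>2"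
    using zero_le_power2[of ?k] zero_le_power2[of ?l] by linarith+
  then have *: "?k \<le> ?M + cmod a * ?k" "?l \<le> ?M + cmod a * ?k"
    using nn by (auto intro!: power2_le_imp_le)
  then show k: "?k \<le> ?M / (1 - cmod a)" using a by (simp add: field_simps)
  have "?l \<le> ?M + cmod a * (?M / (1 - cmod a))"
    using *(2) mult_left_mono[OF k, of "cmod a"] by simp
  also have "\<dots> = ?M / (1 - cmod a)" using a by (simp add: field_simps)
  finally show "?l \<le> ?M / (1 - cmod a)" .
qed

lemma inner_comb_right:
  assumes "f \<in> hcarrier G"
  shows "hinner G f (comb_l n p x c) = (\<Sum>i<n. cnj (c i) * hinner F (f (p i)) x)"
proof -
  have "hinner G f (comb_l n p x c) = (\<Sum>i<n. cnj (c i) * hinner G f (l (p i) x))"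
    unfolding comb_l_def by (intro G.inner_combination_right l_mem p x assms) simp
  also have "\<dots> = (\<Sum>i<n. cnj (c i) * hinner F (f (p i)) x)"
    by (intro sum.cong refl arg_cong2[where f = "(*)"] inner_l p x assms) simp
  finally show ?thesis .
qed

end

text \<open>Pairing f with this combination gives the inner product with x of the difference
  quotient of f at w minus the one at u; the conjugates are there because the second argument is
  conjugate-linear. Each use of \<open>hnorm_comb_le\<close> costs a factor 1/(1 - |z|), and 1/(1 -
  r) comes from \<open>hnorm_k_le\<close>. The points w and u may coincide, which is one reason to
  index by numbers instead of points.\<close>

lemma hnorm_divided_difference_comb:
  assumes w: "cmod w \<le> r" "w \<noteq> z" and u: "cmod u \<le> r" "u \<noteq> z" and z: "cmod z < 1" and r: "r < 1"
    and x: "x \<in> hcarrier F"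
  shows "hnorm G (comb_l 3 ((!) [w, u, z]) x
      ((!) [cnj (1 / (w - z)), - cnj (1 / (u - z)), cnj (1 / (u - z)) - cnj (1 / (w - z))]))
    \<le> (cmod (w - z) + cmod (u - z)) * hnorm F x / ((1 - r) * (1 - cmod z)\<^sup>2)"
proof -
  let ?p = "(!) [w, u, z]"
  let ?c = "(!) [cnj (1 / (w - z)), - cnj (1 / (u - z)), cnj (1 / (u - z)) - cnj (1 / (w - z))]"
  have p: "?p i \<in> ball 0 1" if "i < 3" for i
    using w u z r that by (auto simp: less_Suc_eq numeral_3_eq_3)
  have sum3: "(\<Sum>i<3. g i) = g 0 + g 1 + g 2" for g :: "nat \<Rightarrow> 'b::comm_monoid_add"
    by (simp add: numeral_3_eq_3 numeral_2_eq_2)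
  \<comment> \<open>The factors conj(p_i - z) cancel the denominators at w and u and kill the term
    at z. The sum is again zero, so the estimate applies once more.\<close>
  have 1: "comb_k 3 ?p x (\<lambda>i. ?c i * cnj (?p i - z)) = comb_k 3 ?p x ((!) [1, -1, 0])"
    unfolding comb_k_def sum3 using w u by (simp add: complex_cnj_diff[symmetric] del: complex_cnj_diff)
  have 2: "comb_k 3 ?p x (\<lambda>i. [1, -1, 0] ! i * cnj (?p i - z))
      = hscale H (cnj (w - z)) (k w x) - hscale H (cnj (u - z)) (k u x)"
    unfolding comb_k_def sum3 by (simp del: complex_cnj_diff)
  have wu: "w \<in> ball 0 1" "u \<in> ball 0 1" using w u r by auto
  note mem = H.scale_mem[OF k_mem[OF wu(1) x]] H.scale_mem[OF k_mem[OF wu(2) x]]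
  have "hnorm H (hscale H (cnj (w - z)) (k w x) - hscale H (cnj (u - z)) (k u x))
      \<le> cmod (w - z) * hnorm H (k w x) + cmod (u - z) * hnorm H (k u x)"
    using H.hnorm_diff_le[OF mem, of "cnj (w - z)" "cnj (u - z)"] wu x
    by (simp add: H.hnorm_scale k_mem del: mem_ball mem_ball_0 complex_cnj_diff)
  also have "\<dots> \<le> cmod (w - z) * (hnorm F x / (1 - r)) + cmod (u - z) * (hnorm F x / (1 - r))"
    using w u r x by (intro add_mono mult_left_mono hnorm_k_le) auto
  also have "\<dots> = (cmod (w - z) + cmod (u - z)) * hnorm F x / (1 - r)"
    by (simp add: distrib_right add_divide_distrib)
  finally have 3: "hnorm H (comb_k 3 ?p x (\<lambda>i. [1, -1, 0] ! i * cnj (?p i - z)))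
      \<le> (cmod (w - z) + cmod (u - z)) * hnorm F x / (1 - r)"
    unfolding 2 .
  have "hnorm G (comb_l 3 ?p x ?c) \<le> hnorm H (comb_k 3 ?p x ((!) [1, -1, 0])) / (1 - cmod z)"
    using hnorm_comb_le(2)[of 3 ?p x ?c z, OF p x _ z] unfolding 1 by (simp add: sum3)
  also have "\<dots> \<le> (hnorm H (comb_k 3 ?p x (\<lambda>i. [1, -1, 0] ! i * cnj (?p i - z))) / (1 - cmod z)) / (1 - cmod z)"
    using hnorm_comb_le(1)[of 3 ?p x "(!) [1, -1, 0]" z, OF p x _ z] z
    by (intro divide_right_mono) (simp_all add: sum3)
  also have "\<dots> \<le> ((cmod (w - z) + cmod (u - z)) * hnorm F x / (1 - r) / (1 - cmod z)) / (1 - cmod z)"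
    using 3 z by (intro divide_right_mono) simp_all
  also have "\<dots> = (cmod (w - z) + cmod (u - z)) * hnorm F x / ((1 - r) * (1 - cmod z)\<^sup>2)"
    by (simp add: power2_eq_square)
  finally show ?thesis .
qed

section \<open>Difference quotients of the evaluation and analyticity\<close>

definition quot :: "complex \<Rightarrow> complex \<Rightarrow> (complex \<Rightarrow> 'a) \<Rightarrow> 'a" where
  "quot z w f = hscale F (1 / (w - z)) (f w - f z)"

lemma quot_mem: "z \<in> ball 0 1 \<Longrightarrow> w \<in> ball 0 1 \<Longrightarrow> f \<in> hcarrier G \<Longrightarrow> quot z w f \<in> hcarrier F"
  unfolding quot_def by (intro F.mem G_value)

text \<open>Duality: with y the difference of the quotients, ||y||^2 is the pairing of f with the
  combination formed with the vector y itself. Its norm is at most a constant times ||y||, and one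
  factor ||y|| cancels.\<close>

lemma hnorm_quot_diff_le:
  assumes w: "cmod w \<le> r" "w \<noteq> z" and u: "cmod u \<le> r" "u \<noteq> z" and z: "cmod z < 1" and r: "r < 1"
    and f: "f \<in> hcarrier G"
  shows "hnorm F (quot z w f - quot z u f)
    \<le> (cmod (w - z) + cmod (u - z)) * hnorm G f / ((1 - r) * (1 - cmod z)\<^sup>2)"
proof -
  let ?p = "(!) [w, u, z]"
  let ?c = "(!) [cnj (1 / (w - z)), - cnj (1 / (u - z)), cnj (1 / (u - z)) - cnj (1 / (w - z))]"
  let ?C = "(cmod (w - z) + cmod (u - z)) / ((1 - r) * (1 - cmod z)\<^sup>2)"
  define y where "y = quot z w f - quot z u f"
  have b: "w \<in> ball 0 1" "u \<in> ball 0 1" "z \<in> ball 0 1" using assms by auto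
  have y: "y \<in> hcarrier F" unfolding y_def by (intro F.mem quot_mem b f)
  have p: "?p i \<in> ball 0 1" if "i < 3" for i
    using b that by (auto simp: less_Suc_eq numeral_3_eq_3)
  have "hinner F y y = hinner G f (comb_l 3 ?p y ?c)"
  proof -
    note val = G_value[OF b(1) f] G_value[OF b(2) f] G_value[OF b(3) f]
    have "hinner F y y = 1 / (w - z) * (hinner F (f w) y - hinner F (f z) y)
        - 1 / (u - z) * (hinner F (f u) y - hinner F (f z) y)"
      using F.inner_diff_left[OF quot_mem[OF b(3,1) f] quot_mem[OF b(3,2) f] y] val y
      by (simp add: y_def[symmetric]) (simp add: quot_def F.inner_scale_left F.inner_diff_left F.mem)
    also have "\<dots> = hinner G f (comb_l 3 ?p y ?c)"
      using inner_comb_right[of 3 ?p y f ?c, OF p y f]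
      by (simp add: numeral_3_eq_3 algebra_simps)
    finally show ?thesis .
  qed
  then have "(hnorm F y)\<^sup>2 \<le> cmod (hinner G f (comb_l 3 ?p y ?c))"
    using F.hnorm_power2[OF y] complex_Re_le_cmod by metis
  also have "\<dots> \<le> hnorm G f * hnorm G (comb_l 3 ?p y ?c)"
    by (intro G.cauchy_schwarz f comb_mem p y)
  also have "\<dots> \<le> hnorm G f * ((cmod (w - z) + cmod (u - z)) * hnorm F y / ((1 - r) * (1 - cmod z)\<^sup>2))"
    using G.hnorm_nonneg[OF f] by (intro mult_left_mono hnorm_divided_difference_comb assms y)
  finally have "hnorm F y * hnorm F y \<le> (?C * hnorm G f) * hnorm F y"
    by (simp add: power2_eq_square mult_ac)
  moreover have "0 \<le> ?C * hnorm G f"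
    using z r G.hnorm_nonneg[OF f] by simp
  ultimately have "hnorm F y \<le> ?C * hnorm G f"
    using F.hnorm_nonneg[OF y] by (metis mult_right_le_imp_le order_le_less)
  then show ?thesis by (simp add: y_def)
qed

lemma hnorm_value_le:
  assumes z: "z \<in> ball 0 1" and f: "f \<in> hcarrier G"
  shows "hnorm F (f z) \<le> hnorm G f"
proof -
  have y: "f z \<in> hcarrier F" using G_value assms by blast
  have "(hnorm F (f z))\<^sup>2 = Re (hinner G f (l z (f z)))"
    using y z f by (simp add: inner_l F.hnorm_power2 del: mem_ball mem_ball_0)
  also have "\<dots> \<le> hnorm G f * hnorm G (l z (f z))"
    using G.cauchy_schwarz[OF f l_mem[OF z y]] complex_Re_le_cmod order_trans by blast
  also have "\<dots> \<le> hnorm G f * hnorm F (f z)"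
    using G.hnorm_nonneg[OF f] hnorm_l_le[OF z y] by (rule mult_left_mono[rotated])
  finally have "hnorm F (f z) * hnorm F (f z) \<le> hnorm G f * hnorm F (f z)"
    by (simp add: power2_eq_square)
  then show ?thesis
    using F.hnorm_nonneg[OF y] G.hnorm_nonneg[OF f] by (cases "hnorm F (f z) = 0") auto
qed

lemma G_scale: "hscale G c f z = hscale F c (f z)"
  using reproducing_G by (simp add: reproducing_def pointwise_scale_def)

lemma evaluation_bounded_op: "z \<in> ball 0 1 \<Longrightarrow> (\<lambda>f. f z) \<in> bounded_op G F"
  unfolding bounded_op_def mem_Collect_eq
  by (intro conjI exI[of _ 1]) (auto simp: G_value G_scale hnorm_value_le simp del: mem_ball mem_ball_0)

lemma quot_add: "quot z w (f + g) = quot z w f + quot z w g"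
  by (simp only: quot_def plus_fun_apply add_diff_add F.vs.scale_right_distrib)

lemma quot_scale: "quot z w (hscale G c f) = hscale F c (quot z w f)"
  by (simp add: quot_def G_scale mult.commute flip: F.vs.scale_right_diff_distrib)

lemma evaluation_differentiable:
  assumes z: "z \<in> ball 0 1"
  shows "\<exists>A\<in>bounded_op G F. ((\<lambda>w. op_norm G F (\<lambda>f. quot z w f - A f)) \<longlongrightarrow> 0) (at z within ball 0 1)"
proof -
  \<comment> \<open>The midpoint between |z| and 1. Then |z| + d = r, so the closed disc of radius d
    about z lies in the disc of radius r, where the constants are uniform.\<close>
  define r where "r = (1 + cmod z) / 2"
  define d where "d = 1 - r"
  define C where "C = 1 / ((1 - r) * (1 - cmod z)\<^sup>2)"
  have r: "r < 1" and d: "d > 0" and C: "C \<ge> 0" using z by (auto simp: r_def d_def C_def)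
  have near: "cmod w \<le> r" if "cmod (w - z) \<le> d" for w
    using that norm_triangle_sub[of w z] by (simp add: d_def r_def field_simps)
  have near_ball: "w \<in> ball 0 1" if "cmod (w - z) \<le> d" for w
    using near[OF that] r by simp
  have diff_le: "hnorm F (quot z w f - quot z u f) \<le> C * (cmod (w - z) + cmod (u - z)) * hnorm G f"
    if "w \<noteq> z" "cmod (w - z) \<le> d" "u \<noteq> z" "cmod (u - z) \<le> d" "f \<in> hcarrier G" for w u f
    using hnorm_quot_diff_le[of w r z u f] that near r z by (simp add: C_def mult_ac)
  \<comment> \<open>One sequence of points, the same for every f: the derivative is the pointwise
    limit of quotients along it, and inherits linearity from them.\<close>
  define u :: "nat \<Rightarrow> complex" where "u n = z + of_real (d * inverse (real (Suc n)))" for n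
  have u_dist: "cmod (u n - z) = d * inverse (real (Suc n))" for n
    using d by (simp add: u_def norm_mult norm_inverse del: of_nat_Suc)
  have u: "u n \<noteq> z" "cmod (u n - z) \<le> d" for n
  proof -
    have "inverse (real (Suc n)) \<le> 1" using inverse_le_1_iff[of "real (Suc n)"] by simp
    then show "cmod (u n - z) \<le> d" unfolding u_dist using d by (simp add: mult_left_le)
    have "cmod (u n - z) > 0" unfolding u_dist using d by simp
    then show "u n \<noteq> z" by auto
  qed
  have u_lim: "(\<lambda>n. cmod (u n - z)) \<longlonglongrightarrow> 0"
    unfolding u_dist by (intro tendsto_mult_right_zero LIMSEQ_inverse_real_of_nat)
  note qmem = quot_mem[OF z near_ball[OF u(2)]]
  have "\<exists>y\<in>hcarrier F. (\<lambda>n. hnorm F (quot z (u n) f - y)) \<longlonglongrightarrow> 0" if f: "f \<in> hcarrier G" for f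
  proof (rule F.cauchy_convergent, rule F.cauchyI_vanishing)
    show "(\<lambda>n. C * hnorm G f * cmod (u n - z)) \<longlonglongrightarrow> 0"
      by (intro tendsto_mult_right_zero u_lim)
    show "hnorm F (quot z (u m) f - quot z (u n) f)
        \<le> C * hnorm G f * cmod (u m - z) + C * hnorm G f * cmod (u n - z)" for m n
      using diff_le[OF u u f, of m n] by (simp add: algebra_simps)
  qed (rule qmem[OF f])
  then obtain A where A: "\<And>f. f \<in> hcarrier G \<Longrightarrow> A f \<in> hcarrier F"
    "\<And>f. f \<in> hcarrier G \<Longrightarrow> (\<lambda>n. hnorm F (quot z (u n) f - A f)) \<longlonglongrightarrow> 0" by metis
  \<comment> \<open>Letting n tend to infinity in \<open>diff_le\<close> removes the term |u n - z|.
    The bound is uniform over f of norm at most 1, so pointwise convergence becomes convergence in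
    operator norm.\<close>
  have A_le: "hnorm F (quot z w f - A f) \<le> C * cmod (w - z) * hnorm G f"
    if w: "w \<noteq> z" "cmod (w - z) \<le> d" and f: "f \<in> hcarrier G" for w f
  proof -
    have wq: "quot z w f \<in> hcarrier F" by (intro quot_mem z near_ball w f)
    have "(\<lambda>n. C * (cmod (w - z) + cmod (u n - z)) * hnorm G f + hnorm F (quot z (u n) f - A f))
        \<longlonglongrightarrow> C * (cmod (w - z) + 0) * hnorm G f + 0"
      by (intro tendsto_intros u_lim A f)
    then have lim: "(\<lambda>n. C * (cmod (w - z) + cmod (u n - z)) * hnorm G f + hnorm F (quot z (u n) f - A f))
        \<longlonglongrightarrow> C * cmod (w - z) * hnorm G f" by simp
    have le: "hnorm F (quot z w f - A f)
        \<le> C * (cmod (w - z) + cmod (u n - z)) * hnorm G f + hnorm F (quot z (u n) f - A f)" for n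
      using F.hnorm_triangle_diff[OF wq A(1)[OF f] qmem[OF f], of n] diff_le[OF w u f, of n] by linarith
    show ?thesis using lim le by (intro tendsto_lowerbound[OF lim always_eventually]) auto
  qed
  have A_op: "A \<in> bounded_op G F"
    unfolding bounded_op_def mem_Collect_eq
  proof (intro conjI ballI allI exI)
    show "A f \<in> hcarrier F" if "f \<in> hcarrier G" for f using A that by blast
  next
    fix f g assume fg: "f \<in> hcarrier G" "g \<in> hcarrier G"
    have "(\<lambda>n. hnorm F (quot z (u n) (f + g) - (A f + A g))) \<longlonglongrightarrow> 0"
    proof (rule seq_null_comparison)
      show "(\<lambda>n. hnorm F (quot z (u n) f - A f) + hnorm F (quot z (u n) g - A g)) \<longlonglongrightarrow> 0"
        by (intro tendsto_add_zero A fg)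
      fix n
      have "quot z (u n) (f + g) - (A f + A g) = (quot z (u n) f - A f) + (quot z (u n) g - A g)"
        by (simp add: quot_add)
      then show "norm (hnorm F (quot z (u n) (f + g) - (A f + A g)))
          \<le> hnorm F (quot z (u n) f - A f) + hnorm F (quot z (u n) g - A g)"
        using F.hnorm_triangle[OF F.diff_mem[OF qmem[OF fg(1)] A(1)[OF fg(1)]]
            F.diff_mem[OF qmem[OF fg(2)] A(1)[OF fg(2)]], of n n]
          F.hnorm_nonneg[OF F.add_mem[OF F.diff_mem[OF qmem[OF fg(1)] A(1)[OF fg(1)]]
            F.diff_mem[OF qmem[OF fg(2)] A(1)[OF fg(2)]]], of n n]
        by (simp only: real_norm_def abs_of_nonneg)
    qed
    then show "A (f + g) = A f + A g"
      by (rule F.limit_unique[OF qmem[OF G.add_mem[OF fg]] A(1)[OF G.add_mem[OF fg]]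
            F.add_mem[OF A(1)[OF fg(1)] A(1)[OF fg(2)]] A(2)[OF G.add_mem[OF fg]]])
  next
    fix c f assume f: "f \<in> hcarrier G"
    have "(\<lambda>n. hnorm F (quot z (u n) (hscale G c f) - hscale F c (A f))) \<longlonglongrightarrow> 0"
    proof -
      have "hnorm F (quot z (u n) (hscale G c f) - hscale F c (A f)) = cmod c * hnorm F (quot z (u n) f - A f)" for n
        using qmem[OF f] A(1)[OF f]
        by (simp add: quot_scale F.hnorm_scale F.mem flip: F.vs.scale_right_diff_distrib)
      then show ?thesis using tendsto_mult_right_zero[OF A(2)[OF f], of "cmod c"] by simp
    qed
    then show "A (hscale G c f) = hscale F c (A f)"
      by (rule F.limit_unique[OF qmem[OF G.scale_mem[OF f]] A(1)[OF G.scale_mem[OF f]]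
            F.scale_mem[OF A(1)[OF f]] A(2)[OF G.scale_mem[OF f]]])
  next
    \<comment> \<open>The quotient at the single point \<open>u 0\<close> is bounded because
      evaluations are contractive, and \<open>A\<close> differs from it by a bounded amount by
      \<open>A_le\<close>.\<close>
    fix f assume f: "f \<in> hcarrier G"
    have zu: "hnorm F (f (u 0) - f z) \<le> 2 * hnorm G f"
      using F.hnorm_diff_le[OF G_value G_value, OF near_ball[OF u(2)] f z f, of 0]
        hnorm_value_le[OF z f] hnorm_value_le[OF near_ball[OF u(2)] f, of 0] by linarith
    have "hnorm F (A f) \<le> hnorm F (quot z (u 0) f) + hnorm F (quot z (u 0) f - A f)"
      using F.hnorm_diff_ineq[OF A(1)[OF f] qmem[OF f], of 0] F.hnorm_minus_commute[OF A(1)[OF f] qmem[OF f], of 0]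
      by simp
    also have "hnorm F (quot z (u 0) f) = cmod (1 / (u 0 - z)) * hnorm F (f (u 0) - f z)"
      unfolding quot_def by (intro F.hnorm_scale F.mem G_value near_ball u f z)
    also have "\<dots> \<le> cmod (1 / (u 0 - z)) * (2 * hnorm G f)"
      using zu by (rule mult_left_mono) simp
    also have "hnorm F (quot z (u 0) f - A f) \<le> C * cmod (u 0 - z) * hnorm G f"
      by (intro A_le u f)
    finally show "hnorm F (A f) \<le> (2 * cmod (1 / (u 0 - z)) + C * cmod (u 0 - z)) * hnorm G f"
      by (simp add: algebra_simps)
  qed
  have "((\<lambda>w. op_norm G F (\<lambda>f. quot z w f - A f)) \<longlongrightarrow> 0) (at z within ball 0 1)"
  proof (rule Lim_null_comparison)
    show "\<forall>\<^sub>F w in at z within ball 0 1. norm (op_norm G F (\<lambda>f. quot z w f - A f)) \<le> C * cmod (w - z)"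
      unfolding eventually_at
    proof (intro exI conjI ballI impI)
      fix w :: complex assume w: "w \<noteq> z \<and> dist w z < d"
      then have w: "w \<noteq> z" "cmod (w - z) \<le> d" by (auto simp: dist_norm)
      have "quot z w f - A f \<in> hcarrier F" if "f \<in> hcarrier G" for f
        by (intro F.mem quot_mem z near_ball w A that)
      then show "norm (op_norm G F (\<lambda>f. quot z w f - A f)) \<le> C * cmod (w - z)"
        using op_norm_bounds[OF G.semi_hilbert_axioms F.semi_hilbert_axioms _ A_le[OF w]] C by simp
    qed (rule d)
    have "((\<lambda>w. C * cmod (w - z)) \<longlongrightarrow> C * cmod (z - z)) (at z within ball 0 1)"
      by (intro tendsto_intros)
    then show "((\<lambda>w. C * cmod (w - z)) \<longlongrightarrow> 0) (at z within ball 0 1)" by simp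
  qed
  then show ?thesis using A_op by blast
qed

text \<open>By the reproducing property the adjoint of evaluation at w sends x to
  \<open>l w x\<close>, whose value at z is \<open>defect F K z w x\<close>. Solving for
  \<open>K z w x\<close> divides by the nonzero number \<open>1 - z * cnj w\<close>.\<close>

theorem evaluation_schur_representation: "schur_representation G F K (\<lambda>z f. f z)"
  unfolding schur_representation_def schur_class_def op_analytic_on_def mem_Collect_eq
proof (intro conjI ballI)
  show "complex_hilbert G" by (rule G.complex_hilbert_axioms)
  show "(\<lambda>f. f z) \<in> bounded_op G F" if "z \<in> ball 0 1" for z
    using that by (rule evaluation_bounded_op)
  show "\<exists>A\<in>bounded_op G F. ((\<lambda>w. op_norm G F (\<lambda>f. hscale F (1 / (w - z)) (f w - f z) - A f)) \<longlongrightarrow> 0)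
      (at z within ball 0 1)" if "z \<in> ball 0 1" for z
    using evaluation_differentiable[OF that] by (simp add: quot_def)
  show "op_norm G F (\<lambda>f. f z) \<le> 1" if "z \<in> ball 0 1" for z
    using op_norm_bounds(2)[OF G.semi_hilbert_axioms F.semi_hilbert_axioms, of "\<lambda>f. f z" 1]
      G_value hnorm_value_le that by simp
  fix z w :: complex and x
  assume *: "z \<in> ball 0 1" "w \<in> ball 0 1" "x \<in> hcarrier F"
  have "adj G F (\<lambda>f. f w) x = l w x"
    by (intro adj_eqI G.complex_hilbert_axioms l_mem inner_l[symmetric] *)
  then show "K z w x = hscale F (1 / (1 - z * cnj w)) (x - adj G F (\<lambda>f. f w) x z)"
    using * one_minus_mult_cnj_nonzero[OF *(1,2)] by (simp add: l_value defect_def del: mem_ball mem_ball_0)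
qed

end

theorem theorem3p1:
  fixes F :: "'a::ab_group_add hilbert"
    and K :: "complex \<Rightarrow> complex \<Rightarrow> 'a \<Rightarrow> 'a"
  assumes "complex_hilbert F"
    and "is_kernel (ball 0 1) F K"
  shows
    "((\<exists>(E :: (complex \<Rightarrow> 'a) hilbert) \<Theta>. schur_representation E F K \<Theta>)
        \<longleftrightarrow> is_kernel (ball 0 1) F (\<lambda>z w x. x - hscale F (1 - z * cnj w) (K z w x)))
     \<and> (\<forall>(E :: 'b::ab_group_add hilbert) \<Theta>. schur_representation E F K \<Theta>
        \<longrightarrow> is_kernel (ball 0 1) F (\<lambda>z w x. x - hscale F (1 - z * cnj w) (K z w x)))"
proof -
  have defect: "(\<lambda>z w x. x - hscale F (1 - z * cnj w) (K z w x)) = defect F K"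
    by (simp add: defect_def fun_eq_iff)
  have "\<exists>(E :: (complex \<Rightarrow> 'a) hilbert) \<Theta>. schur_representation E F K \<Theta>"
    if L: "is_kernel (ball 0 1) F (defect F K)"
  proof -
    obtain H k where H: "reproducing (ball 0 1) F K H k"
      using reproducing_kernel_hilbert_space[OF assms] by blast
    obtain G l where G: "reproducing (ball 0 1) F (defect F K) G l"
      using reproducing_kernel_hilbert_space[OF assms(1) L] by blast
    interpret kernel_pair F K H k G l
      by (intro kernel_pair.intro kernel_pair_axioms.intro assms H G)
    show ?thesis using evaluation_schur_representation by blast
  qed
  \<comment> \<open>The necessity lemma is polymorphic in the type of \<open>E\<close> and is used
    at two types: the function type of the equivalence, and the free type \<open>'b\<close> of the
    second conjunct.\<close>
  then show ?thesis
    unfolding defect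
    by (intro conjI iffI allI impI; blast intro: schur_representation_imp_defect_kernel[OF assms])
qed

end
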